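(* Let $(\mathcal{H},\mathcal{E}_t)$ be a multiplicity-free, 2-homogeneous quantum metric $G$-space of diameter $r$, with $W_t(j)$ coefficients $W_t(j)\in\mathbb{R}$ ($0\le t,j\le r$). Let $\mathcal{C}\subseteq\mathcal{H}$ be a quantum code of dimension $K$ and distance $d$, where $1\le d\le r$, and let $(A_t)_{0\le t\le r}$ be the distance distribution of $\mathcal{C}$, $A_t=\frac{\dim\mathcal{H}}{\dim\mathcal{C}}\operatorname{tr}(P\,\Pi_t(P))$, where $P$ is the orthogonal projection onto $\mathcal{C}$. Then $(A_t)$ is a solution of the linear system $$A_t\ge 0\ \ (0\le t\le r),\qquad A_0=K,\qquad K\sum_{j=0}^{r}W_t(j)A_j=A_t\ \ (0\le t\le d-1),\qquad K\sum_{j=0}^{r}W_t(j)A_j\ge A_t\ \ (0\le t\le r).$$ Consequently, if this linear system (with parameters $K,d$) has no solution $(A_0,\dots,A_r)\in\mathbb{R}^{r+1}$, then there is no quantum code in $\mathcal{H}$ of dimension $K$ and distance $d$.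
   Context: Quantum metric: $\mathcal{H}$ is a finite-dimensional complex Hilbert space and $\mathcal{L}(\mathcal{H})$ its space of linear operators, with Hilbert–Schmidt inner product $\langle E,F\rangle=\operatorname{tr}(E^*F)$. Given a subspace $\mathcal{E}\subseteq\mathcal{L}(\mathcal{H})$ with $I_{\mathcal{H}}\in\mathcal{E}$ and $\mathcal{E}^*=\mathcal{E}$ (closed under adjoints), the quantum graph metric generated by $\mathcal{E}$ is the family $\mathcal{E}_t=\mathbb{C}I_{\mathcal{H}}$ for $0\le t<1$ and $\mathcal{E}_t=\mathcal{E}^{\lfloor t\rfloor}$ (span of products of $\lfloor t\rfloor$ elements of $\mathcal{E}$) for $t\ge1$. It is assumed connected: $\mathcal{E}_r=\mathcal{L}(\mathcal{H})$ for some finite $r$; the smallest such $r$ is the diameter. Put $\mathcal{V}_0=\mathbb{C}I_{\mathcal{H}}$ and $\mathcal{V}_t=\mathcal{E}_t\cap\mathcal{E}_{t-1}^{\perp}$ for integers $1\le t\le r$, so $\mathcal{L}(\mathcal{H})=\bigoplus_{t=0}^r\mathcal{V}_t$ orthogonally. Quantum codes: a quantum code is a subspace $\mathcal{C}\subseteq\mathcal{H}$, with orthogonal projection $P$. It detects $E\in\mathcal{L}(\mathcal{H})$ if $PEP=\varepsilon(E)P$ for some $\varepsilon(E)\in\mathbb{C}$. The (minimum) distance of $\mathcal{C}$ is the largest $d$ such that $\mathcal{C}$ detects all $E\in\mathcal{E}_{d-1}$. Symmetry: $\operatorname{Isom}(\mathcal{H},\mathcal{E}_t)$ is the group of unitaries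 $U$ on $\mathcal{H}$ with $\mathcal{E}_t\subseteq U^*\mathcal{E}_tU$ for all $t\ge0$. For a group $G$, $(\mathcal{H},\mathcal{E}_t)$ is a quantum metric $G$-space if a homomorphism $R:G\to\operatorname{Isom}(\mathcal{H},\mathcal{E}_t)$ is given; $G$ then acts on $\mathcal{L}(\mathcal{H})$ by $g\cdot E=R(g)ER(g)^*$. It is multiplicity-free if $\mathcal{L}(\mathcal{H})$ is a multiplicity-free representation of $G$ under this action, and 2-homogeneous if each $\mathcal{V}_t$ is an irreducible representation of $G$. Superoperators: let $\mathcal{L}(\mathcal{H})_{\mathbb{R}}$ be the real space of self-adjoint operators. With $\mathcal{B}_t$ any orthonormal basis of $\mathcal{V}_t$, define on $\mathcal{L}(\mathcal{H})_{\mathbb{R}}$ the maps $\Phi_t(X)=\sum_{E\in\mathcal{B}_t}EXE^*$ and $\Pi_t(X)=\sum_{E\in\mathcal{B}_t}\operatorname{tr}(E^*X)E$ (the orthogonal projection onto $\mathcal{V}_t$); both are independent of the choice of $\mathcal{B}_t$. The $W_t(j)$ coefficients are the (existing, unique) real numbers with $\Phi_t=\sum_{j=0}^rW_t(j)\Pi_j$ for $0\le t\le r$. *)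

theory Defs
  imports "HOL-Analysis.Analysis" "HOL-Algebra.Group"
begin

text \<open>
  The Hilbert space is \<open>complex ^ 'n\<close> with its standard inner product, and the linear operators
  on it are identified with their matrices, of type \<open>complex ^ 'n ^ 'n\<close>. Complex subspaces of
  the Hilbert space and their dimension are \<^const>\<open>vec.subspace\<close> and \<^const>\<open>vec.dim\<close>.
  On matrices the scalar multiplication \<open>*s\<close> is not the one by complex numbers, so the complex
  vector space of operators is set up separately.
\<close>

type_synonym 'n cop = "complex ^ 'n ^ 'n"

definition op_scale :: "complex \<Rightarrow> 'n::finite cop \<Rightarrow> 'n cop"  (infixr \<open>*\<^sub>o\<close> 75)
  where "c *\<^sub>o A = (\<chi> i j. c * A $ i $ j)"

interpretation cop: vector_space "op_scale :: complex \<Rightarrow> 'n::finite cop \<Rightarrow> 'n cop"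
  by unfold_locales (simp_all add: op_scale_def vec_eq_iff algebra_simps)

definition adj :: "'n::finite cop \<Rightarrow> 'n cop"  (\<open>(_\<^sup>\<dagger>)\<close> [1000] 999)
  where "A\<^sup>\<dagger> = (\<chi> i j. cnj (A $ j $ i))"

definition hs_inner :: "'n::finite cop \<Rightarrow> 'n cop \<Rightarrow> complex"
  where "hs_inner A B = trace (A\<^sup>\<dagger> ** B)"

definition hs_perp :: "'n::finite cop set \<Rightarrow> 'n cop set"
  where "hs_perp S = {A. \<forall>B\<in>S. hs_inner B A = 0}"

definition self_adjoint :: "'n::finite cop \<Rightarrow> bool"
  where "self_adjoint A \<longleftrightarrow> A\<^sup>\<dagger> = A"

definition unitary :: "'n::finite cop \<Rightarrow> bool"
  where "unitary U \<longleftrightarrow> U\<^sup>\<dagger> ** U = mat 1 \<and> U ** U\<^sup>\<dagger> = mat 1"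


subsection \<open>Quantum graph metrics\<close>

definition quantum_graph :: "'n::finite cop set \<Rightarrow> bool"
  where "quantum_graph \<E> \<longleftrightarrow> cop.subspace \<E> \<and> mat 1 \<in> \<E> \<and> adj ` \<E> = \<E>"

definition op_power :: "'n::finite cop set \<Rightarrow> nat \<Rightarrow> 'n cop set"
  where "op_power \<E> k = cop.span {foldr (**) As (mat 1) | As. length As = k \<and> set As \<subseteq> \<E>}"

definition graph_metric :: "'n::finite cop set \<Rightarrow> real \<Rightarrow> 'n cop set"
  where "graph_metric \<E> t = (if t < 1 then cop.span {mat 1} else op_power \<E> (nat \<lfloor>t\<rfloor>))"

definition metric_connected :: "'n::finite cop set \<Rightarrow> bool"
  where "metric_connected \<E> \<longleftrightarrow> (\<exists>r\<ge>0. graph_metric \<E> r = UNIV)"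

text \<open>
  Since \<^term>\<open>graph_metric \<E> t\<close> depends only on \<open>\<lfloor>t\<rfloor>\<close>, the smallest real \<open>t \<ge> 0\<close> for which it is
  everything is a natural number.
\<close>
definition metric_diameter :: "'n::finite cop set \<Rightarrow> nat"
  where "metric_diameter \<E> = (LEAST r. graph_metric \<E> (real r) = UNIV)"

definition sphere_space :: "'n::finite cop set \<Rightarrow> nat \<Rightarrow> 'n cop set"
  where "sphere_space \<E> t =
    (if t = 0 then cop.span {mat 1}
     else graph_metric \<E> (real t) \<inter> hs_perp (graph_metric \<E> (real t - 1)))"


subsection \<open>Quantum codes\<close>

definition cinner :: "complex ^ 'n::finite \<Rightarrow> complex ^ 'n \<Rightarrow> complex"
  where "cinner x y = (\<Sum>i\<in>UNIV. cnj (x $ i) * y $ i)"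

definition code_proj :: "(complex ^ 'n::finite) set \<Rightarrow> 'n cop"
  where "code_proj C = (THE P. \<forall>x. P *v x \<in> C \<and> (\<forall>y\<in>C. cinner y (x - P *v x) = 0))"

definition detects :: "(complex ^ 'n::finite) set \<Rightarrow> 'n cop \<Rightarrow> bool"
  where "detects C A \<longleftrightarrow> (\<exists>\<epsilon>. code_proj C ** A ** code_proj C = \<epsilon> *\<^sub>o code_proj C)"

definition detects_below :: "'n::finite cop set \<Rightarrow> (complex ^ 'n) set \<Rightarrow> nat \<Rightarrow> bool"
  where "detects_below \<E> C d \<longleftrightarrow> 1 \<le> d \<and> (\<forall>A\<in>graph_metric \<E> (real d - 1). detects C A)"

text \<open>
  A code that detects every operator has no distance in this sense.
\<close>
definition has_distance :: "'n::finite cop set \<Rightarrow> (complex ^ 'n) set \<Rightarrow> nat \<Rightarrow> bool"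
  where "has_distance \<E> C d \<longleftrightarrow>
    detects_below \<E> C d \<and> (\<forall>d'. detects_below \<E> C d' \<longrightarrow> d' \<le> d)"

definition quantum_code :: "'n::finite cop set \<Rightarrow> (complex ^ 'n) set \<Rightarrow> nat \<Rightarrow> nat \<Rightarrow> bool"
  where "quantum_code \<E> C K d \<longleftrightarrow> vec.subspace C \<and> vec.dim C = K \<and> has_distance \<E> C d"


subsection \<open>Symmetry\<close>

definition isom_group :: "'n::finite cop set \<Rightarrow> 'n cop monoid"
  where "isom_group \<E> =
    \<lparr>carrier = {U. unitary U \<and>
       (\<forall>t\<ge>0. graph_metric \<E> t \<subseteq> (\<lambda>A. U\<^sup>\<dagger> ** A ** U) ` graph_metric \<E> t)},
     monoid.mult = (**), one = mat 1\<rparr>"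

definition quantum_metric_space ::
    "('g, 'm) monoid_scheme \<Rightarrow> 'n::finite cop set \<Rightarrow> ('g \<Rightarrow> 'n cop) \<Rightarrow> bool"
  where "quantum_metric_space G \<E> R \<longleftrightarrow>
    group G \<and> quantum_graph \<E> \<and> metric_connected \<E> \<and> R \<in> hom G (isom_group \<E>)"

definition conj_act :: "('g \<Rightarrow> 'n::finite cop) \<Rightarrow> 'g \<Rightarrow> 'n cop \<Rightarrow> 'n cop"
  where "conj_act R g A = R g ** A ** (R g)\<^sup>\<dagger>"

definition subrep ::
    "('g, 'm) monoid_scheme \<Rightarrow> ('g \<Rightarrow> 'n::finite cop) \<Rightarrow> 'n cop set \<Rightarrow> bool"
  where "subrep G R W \<longleftrightarrow>
    cop.subspace W \<and> (\<forall>g\<in>carrier G. \<forall>A\<in>W. conj_act R g A \<in> W)"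

definition irreducible_rep ::
    "('g, 'm) monoid_scheme \<Rightarrow> ('g \<Rightarrow> 'n::finite cop) \<Rightarrow> 'n cop set \<Rightarrow> bool"
  where "irreducible_rep G R W \<longleftrightarrow>
    subrep G R W \<and> W \<noteq> {0} \<and> (\<forall>W'. subrep G R W' \<and> W' \<subseteq> W \<longrightarrow> W' = {0} \<or> W' = W)"

text \<open>
  The intertwiner is given as a linear map on all operators, of which only the restriction to \<open>W\<close>
  matters; every linear map on a subspace has such an extension.
\<close>
definition rep_iso ::
    "('g, 'm) monoid_scheme \<Rightarrow> ('g \<Rightarrow> 'n::finite cop) \<Rightarrow> 'n cop set \<Rightarrow> 'n cop set \<Rightarrow> bool"
  where "rep_iso G R W W' \<longleftrightarrow>
    (\<exists>f. Vector_Spaces.linear op_scale op_scale f \<and> bij_betw f W W' \<and>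
         (\<forall>g\<in>carrier G. \<forall>A\<in>W. f (conj_act R g A) = conj_act R g (f A)))"

text \<open>
  The space of all operators is the internal direct sum of the pairwise non-isomorphic
  irreducible subrepresentations in \<open>\<W>\<close>.
\<close>
definition multiplicity_free ::
    "('g, 'm) monoid_scheme \<Rightarrow> ('g \<Rightarrow> 'n::finite cop) \<Rightarrow> bool"
  where "multiplicity_free G R \<longleftrightarrow>
    (\<exists>\<W>. finite \<W> \<and> (\<forall>W\<in>\<W>. irreducible_rep G R W) \<and>
         (\<forall>A. \<exists>!f. f \<in> (\<Pi>\<^sub>E W\<in>\<W>. W) \<and> A = (\<Sum>W\<in>\<W>. f W)) \<and>
         (\<forall>W\<in>\<W>. \<forall>W'\<in>\<W>. W \<noteq> W' \<longrightarrow> \<not> rep_iso G R W W'))"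

definition two_homogeneous ::
    "('g, 'm) monoid_scheme \<Rightarrow> 'n::finite cop set \<Rightarrow> ('g \<Rightarrow> 'n cop) \<Rightarrow> bool"
  where "two_homogeneous G \<E> R \<longleftrightarrow>
    (\<forall>t\<le>metric_diameter \<E>. irreducible_rep G R (sphere_space \<E> t))"


subsection \<open>Superoperators and distance distribution\<close>

definition hs_orthonormal_basis :: "'n::finite cop set \<Rightarrow> 'n cop set \<Rightarrow> bool"
  where "hs_orthonormal_basis V B \<longleftrightarrow>
    finite B \<and> cop.span B = V \<and> (\<forall>A\<in>B. \<forall>A'\<in>B. hs_inner A A' = (if A = A' then 1 else 0))"

definition sphere_basis :: "'n::finite cop set \<Rightarrow> nat \<Rightarrow> 'n cop set"
  where "sphere_basis \<E> t = (SOME B. hs_orthonormal_basis (sphere_space \<E> t) B)"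

definition Phi :: "'n::finite cop set \<Rightarrow> nat \<Rightarrow> 'n cop \<Rightarrow> 'n cop"
  where "Phi \<E> t X = (\<Sum>A\<in>sphere_basis \<E> t. A ** X ** A\<^sup>\<dagger>)"

definition Proj :: "'n::finite cop set \<Rightarrow> nat \<Rightarrow> 'n cop \<Rightarrow> 'n cop"
  where "Proj \<E> t X = (\<Sum>A\<in>sphere_basis \<E> t. trace (A\<^sup>\<dagger> ** X) *\<^sub>o A)"

text \<open>
  The coefficients are indexed by \<open>0 \<le> j \<le> r\<close>, where \<open>r\<close> is the diameter; requiring the value \<open>0\<close>
  for \<open>j > r\<close> makes the function on the natural numbers unique.
\<close>
definition W_coeff :: "'n::finite cop set \<Rightarrow> nat \<Rightarrow> nat \<Rightarrow> real"
  where "W_coeff \<E> t =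
    (THE w. (\<forall>j>metric_diameter \<E>. w j = 0) \<and>
       (\<forall>X. self_adjoint X \<longrightarrow> Phi \<E> t X = (\<Sum>j\<le>metric_diameter \<E>. w j *\<^sub>R Proj \<E> j X)))"

text \<open>
  The trace below is real, because the projection and its image under \<^term>\<open>Proj \<E> t\<close> are both
  self-adjoint.
\<close>
definition distance_distribution ::
    "'n::finite cop set \<Rightarrow> (complex ^ 'n) set \<Rightarrow> nat \<Rightarrow> real"
  where "distance_distribution \<E> C t =
    real CARD('n) / real (vec.dim C) * Re (trace (code_proj C ** Proj \<E> t (code_proj C)))"

definition lp_solution ::
    "(nat \<Rightarrow> nat \<Rightarrow> real) \<Rightarrow> nat \<Rightarrow> nat \<Rightarrow> nat \<Rightarrow> (nat \<Rightarrow> real) \<Rightarrow> bool"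
  where "lp_solution W r K d A \<longleftrightarrow>
    (\<forall>t\<le>r. 0 \<le> A t) \<and>
    A 0 = real K \<and>
    (\<forall>t<d. real K * (\<Sum>j\<le>r. W t j * A j) = A t) \<and>
    (\<forall>t\<le>r. real K * (\<Sum>j\<le>r. W t j * A j) \<ge> A t)"

end

theory Submission
  imports Defs
begin

text \<open>
  Independence of \<open>\<Phi>\<^sub>t\<close> from the orthonormal basis makes it \<open>G\<close>-equivariant and self-adjoint; since the
  \<open>\<V>\<^sub>j\<close> are irreducible and pairwise non-isomorphic, Schur's lemma makes it a real scalar on each of
  them, and these scalars are the \<open>W\<^sub>t(j)\<close>. With \<open>n = dim \<H>\<close> and \<open>M\<^sub>E = P E P\<close>, one gets
  \<open>K \<Sum>\<^sub>j W\<^sub>t(j) A\<^sub>j = n tr(P \<Phi>\<^sub>t(P)) = n \<Sum>\<^sub>E \<langle>M\<^sub>E, M\<^sub>E\<rangle>\<close> and \<open>A\<^sub>t = (n/K) \<Sum>\<^sub>E |\<langle>P, M\<^sub>E\<rangle>|\<^sup>2\<close>, summed over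
  an orthonormal basis of \<open>\<V>\<^sub>t\<close>. Since \<open>\<langle>P, P\<rangle> = K\<close>, the inequality is Cauchy--Schwarz, with equality when
  \<open>M\<^sub>E\<close> is a multiple of \<open>P\<close>, that is, when \<open>E\<close> is detected.
\<close>

section \<open>Complex inner product spaces\<close>

text \<open>One abstract setting covers both the vectors of the Hilbert space, with
  \<open>cinner\<close>, and the operators, with \<open>hs_inner\<close>. The form is linear in its
  second argument; conjugate linearity in the first follows from \<open>ip_commute\<close>.\<close>

locale complex_inner_product = vector_space scale
  for scale :: "complex \<Rightarrow> 'a::ab_group_add \<Rightarrow> 'a" (infixr \<open>*\<^sub>c\<close> 75) +
  fixes ip :: "'a \<Rightarrow> 'a \<Rightarrow> complex"
  assumes ip_add_right: "ip x (y + z) = ip x y + ip x z"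
    and ip_scale_right: "ip x (c *\<^sub>c y) = c * ip x y"
    and ip_commute: "ip y x = cnj (ip x y)"
    and ip_pos: "x \<noteq> 0 \<Longrightarrow> 0 < Re (ip x x)"
begin

definition orthonormal :: "'a set \<Rightarrow> bool"
  where "orthonormal B \<longleftrightarrow> (\<forall>a\<in>B. \<forall>b\<in>B. ip a b = (if a = b then 1 else 0))"

text \<open>For a finite orthonormal \<open>B\<close> this is the orthogonal projection of
  \<open>x\<close> onto \<open>span B\<close>. It later describes both \<open>Proj\<close> and the
  projection onto a code.\<close>

definition expansion :: "'a set \<Rightarrow> 'a \<Rightarrow> 'a"
  where "expansion B x = (\<Sum>b\<in>B. ip b x *\<^sub>c b)"

lemma ip_zero_right [simp]: "ip x 0 = 0"
  using ip_add_right[of x 0 0] by simp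

lemma ip_zero_left [simp]: "ip 0 x = 0"
  using ip_commute[of 0 x] by simp

lemma ip_minus_right: "ip x (- y) = - ip x y"
  using ip_add_right[of x y "- y"] by (simp add: eq_neg_iff_add_eq_0 add.commute)

lemma ip_diff_right: "ip x (y - z) = ip x y - ip x z"
  using ip_add_right[of x y "- z"] by (simp add: ip_minus_right)

lemma ip_sum_right: "ip x (sum f A) = (\<Sum>a\<in>A. ip x (f a))"
  by (induction A rule: infinite_finite_induct) (simp_all add: ip_add_right)

lemma ip_add_left: "ip (x + y) z = ip x z + ip y z"
  by (simp add: ip_commute[of _ z] ip_add_right)

lemma ip_diff_left: "ip (x - y) z = ip x z - ip y z"
  by (simp add: ip_commute[of _ z] ip_diff_right)

lemma ip_scale_left: "ip (c *\<^sub>c x) z = cnj c * ip x z"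
  by (simp add: ip_commute[of _ z] ip_scale_right)

lemma ip_self_real: "ip x x = of_real (Re (ip x x))"
  using ip_commute[of x x] by (simp add: complex_eq_iff)

lemma ip_self_eq_0_iff [simp]: "ip x x = 0 \<longleftrightarrow> x = 0"
  using ip_pos[of x] by fastforce

lemma ip_self_nonneg: "0 \<le> Re (ip x x)"
  using ip_pos[of x] by (cases "x = 0") auto

lemma Cauchy_Schwarz_ip: "(cmod (ip x y))\<^sup>2 \<le> Re (ip x x) * Re (ip y y)"
proof (cases "x = 0")
  case False
  define k where "k = Re (ip x x)"
  have k: "k > 0" "ip x x = of_real k"
    using ip_pos[OF False] ip_self_real[of x] by (auto simp: k_def)
  \<comment> \<open>With this coefficient, \<open>c *\<^sub>c x\<close> is the projection of
    \<open>y\<close> onto the line of \<open>x\<close>; the inequality says that the residue has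
    nonnegative squared norm.\<close>
  define c where "c = ip x y / of_real k"
  have "ip (y - c *\<^sub>c x) (y - c *\<^sub>c x)
      = ip y y - c * ip y x - cnj c * (ip x y - c * of_real k)"
    by (simp add: ip_diff_left ip_diff_right ip_scale_left ip_scale_right k algebra_simps)
  also have "\<dots> = ip y y - of_real ((cmod (ip x y))\<^sup>2 / k)"
    using k(1) ip_commute[of x y] complex_norm_square[of "ip y x"]
    by (simp add: c_def mult.commute)
  finally have "0 \<le> Re (ip y y) - (cmod (ip x y))\<^sup>2 / k"
    using ip_self_nonneg[of "y - c *\<^sub>c x"] by simp
  then show ?thesis
    using k by (simp add: field_simps flip: k_def)
qed simp

section \<open>Orthonormal expansions and Gram-Schmidt orthogonalization\<close>

lemma orthogonal_span:
  assumes "\<And>b. b \<in> B \<Longrightarrow> ip b x = 0" and "y \<in> span B"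
  shows "ip y x = 0"
  using assms(2)
  by (induction rule: span_induct_alt) (simp_all add: ip_add_left ip_scale_left assms(1))

context
  fixes B
  assumes fin: "finite B" and on: "orthonormal B"
begin

lemma expansion_in_span: "expansion B x \<in> span B"
  unfolding expansion_def by (intro span_sum span_scale span_base)

lemma ip_basis_expansion: "a \<in> B \<Longrightarrow> ip a (expansion B x) = ip a x"
proof -
  assume a: "a \<in> B"
  then have "ip a (expansion B x) = (\<Sum>b\<in>B. if a = b then ip b x else 0)"
    using on unfolding expansion_def ip_sum_right ip_scale_right orthonormal_def
    by (intro sum.cong) auto
  then show "ip a (expansion B x) = ip a x"
    using a fin by simp
qed

lemma ip_expansion_residue: "y \<in> span B \<Longrightarrow> ip y (x - expansion B x) = 0"
  by (rule orthogonal_span) (simp_all add: ip_diff_right ip_basis_expansion)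

text \<open>The difference of the two candidates lies in the span and is orthogonal to the span,
  hence to itself.\<close>

lemma expansion_unique:
  assumes "p \<in> span B" and "\<And>y. y \<in> span B \<Longrightarrow> ip y (x - p) = 0"
  shows "expansion B x = p"
proof -
  let ?d = "expansion B x - p"
  have "?d \<in> span B"
    by (intro span_diff expansion_in_span assms)
  moreover have "ip ?d (x - p) = 0" "ip ?d (x - expansion B x) = 0"
    using calculation assms(2) ip_expansion_residue by auto
  ultimately have "ip ?d ?d = 0"
    by (simp add: ip_diff_right)
  then show ?thesis
    by simp
qed

lemma expansion_span: "x \<in> span B \<Longrightarrow> expansion B x = x"
  by (rule expansion_unique) simp_all

text \<open>Apply \<open>ip y\<close> to the expansion of \<open>x\<close>. Only \<open>x\<close>
  has to lie in the span.\<close>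

lemma Parseval_ip: "x \<in> span B \<Longrightarrow> (\<Sum>e\<in>B. ip y e * ip e x) = ip y x"
  using arg_cong[OF expansion_span, of x "ip y"]
  by (simp add: expansion_def ip_sum_right ip_scale_right mult.commute)

text \<open>A basis vector in the span of the others would be orthogonal to itself, against its norm
  being 1. This identifies the cardinality of an orthonormal basis with the dimension.\<close>

lemma orthonormal_independent: "independent B"
proof -
  have "b \<notin> span (B - {b})" if "b \<in> B" for b
  proof
    assume "b \<in> span (B - {b})"
    then have "ip b b = 0"
      using on that by (intro orthogonal_span[of "B - {b}" b b]) (auto simp: orthonormal_def)
    then show False
      using on that by (metis orthonormal_def zero_neq_one)
  qed
  then show ?thesis
    by (auto simp: dependent_def)
qed

end

lemma Gram_Schmidt:
  assumes "finite S"
  shows "\<exists>B. finite B \<and> orthonormal B \<and> span B = span S"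
  using assms
proof (induction S)
  case empty
  show ?case
    by (intro exI[of _ "{}"]) (simp add: orthonormal_def)
next
  case (insert x S)
  then obtain B where B: "finite B" "orthonormal B" "span B = span S"
    by blast
  define u where "u = x - expansion B x"
  have x: "x = u + expansion B x"
    by (simp add: u_def)
  have eS: "expansion B x \<in> span S"
    using expansion_in_span[OF B(1,2), of x] B(3) by simp
  show ?case
  proof (cases "u = 0")
    \<comment> \<open>A vanishing residue means that \<open>x\<close> adds nothing to the span, so
      \<open>B\<close> still serves; otherwise the normalized residue is adjoined.\<close>
    case True
    then have "x \<in> span S"
      using x eS by simp
    then show ?thesis
      using B by (metis span_redundant)
  next
    case False
    define k where "k = sqrt (Re (ip u u))"
    have k: "k > 0" "ip u u = of_real (k\<^sup>2)"
      using ip_pos[OF False] ip_self_real[of u] by (auto simp: k_def)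
    define v where "v = of_real (1 / k) *\<^sub>c u"
    have perp: "ip b v = 0" if "b \<in> B" for b
      using ip_expansion_residue[OF B(1,2), of b x] that
      by (simp add: v_def u_def ip_scale_right span_base)
    have perp': "ip v b = 0" if "b \<in> B" for b
      using perp[OF that] ip_commute[of v b] by simp
    have vv: "ip v v = 1"
      using k by (simp add: v_def ip_scale_left ip_scale_right power2_eq_square)
    have on: "orthonormal (insert v B)"
      using B(2) perp perp' vv by (fastforce simp: orthonormal_def)
    have u: "u = of_real k *\<^sub>c v"
      using k by (simp add: v_def)
    have SB: "S \<subseteq> span (insert v B)" "B \<subseteq> span (insert x S)"
      using B(3) span_superset span_mono[of B "insert v B"] span_mono[of S "insert x S"] by blast+
    have "x \<in> span (insert v B)"
      by (subst x, unfold u) (meson B(1,2) expansion_in_span insertI1 span_add span_base span_mono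
          span_scale subset_insertI subsetD)
    moreover have "v \<in> span (insert x S)"
      unfolding v_def u_def
      using eS span_mono[of S "insert x S"]
      by (intro span_scale span_diff) (auto intro: span_base)
    ultimately have "span (insert v B) = span (insert x S)"
      using SB by (intro subset_antisym span_minimal) auto
    then show ?thesis
      using on B(1) by blast
  qed
qed

end

section \<open>Operators with the Hilbert--Schmidt inner product\<close>

lemma op_scale_nth [simp]: "(c *\<^sub>o A) $ i $ j = c * A $ i $ j"
  by (simp add: op_scale_def)

lemma adj_nth [simp]: "A\<^sup>\<dagger> $ i $ j = cnj (A $ j $ i)"
  by (simp add: adj_def)

lemma adj_adj [simp]: "(A\<^sup>\<dagger>)\<^sup>\<dagger> = A"
  by (simp add: vec_eq_iff)

lemma adj_zero [simp]: "0\<^sup>\<dagger> = 0"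
  by (simp add: vec_eq_iff)

lemma adj_mat_1 [simp]: "(mat 1)\<^sup>\<dagger> = mat 1"
  by (simp add: vec_eq_iff mat_def)

lemma adj_add: "(A + B)\<^sup>\<dagger> = A\<^sup>\<dagger> + B\<^sup>\<dagger>"
  by (simp add: vec_eq_iff)

lemma adj_scale: "(c *\<^sub>o A)\<^sup>\<dagger> = cnj c *\<^sub>o A\<^sup>\<dagger>"
  by (simp add: vec_eq_iff)

lemma adj_sum: "(sum f S)\<^sup>\<dagger> = (\<Sum>x\<in>S. (f x)\<^sup>\<dagger>)"
  by (induction S rule: infinite_finite_induct) (simp_all add: adj_add)

lemma adj_mult: "(A ** B)\<^sup>\<dagger> = B\<^sup>\<dagger> ** A\<^sup>\<dagger>"
  by (simp add: vec_eq_iff matrix_matrix_mult_def mult.commute)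

lemma op_scale_mult_left: "(c *\<^sub>o A) ** B = c *\<^sub>o (A ** B)"
  by (simp add: vec_eq_iff matrix_matrix_mult_def sum_distrib_left mult.assoc)

lemma op_scale_mult_right: "A ** (c *\<^sub>o B) = c *\<^sub>o (A ** B)"
  by (simp add: vec_eq_iff matrix_matrix_mult_def sum_distrib_left mult.left_commute)

lemma matrix_mult_zero [simp]:
  fixes A :: "'n::finite cop"
  shows "A ** 0 = 0" "0 ** A = 0"
  by (simp_all add: vec_eq_iff matrix_matrix_mult_def)

lemma matrix_add_mult: "((A :: 'n::finite cop) + B) ** (C :: 'n cop) = A ** C + B ** C"
  by (simp add: vec_eq_iff matrix_matrix_mult_def distrib_right sum.distrib)

lemma matrix_sum_mult: "(sum f S :: 'n::finite cop) ** (C :: 'n cop) = (\<Sum>x\<in>S. f x ** C)"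
  by (induction S rule: infinite_finite_induct) (simp_all add: matrix_add_mult)

lemma matrix_mult_sum: "(C :: 'n::finite cop) ** (sum f S :: 'n cop) = (\<Sum>x\<in>S. C ** f x)"
  by (induction S rule: infinite_finite_induct) (simp_all add: matrix_add_ldistrib)

lemma trace_scale: "trace (c *\<^sub>o A) = c * trace A"
  by (simp add: trace_def sum_distrib_left)

lemma trace_sum: "trace (sum f S) = (\<Sum>x\<in>S. trace (f x :: 'n::finite cop))"
  by (induction S rule: infinite_finite_induct) (simp_all add: trace_add trace_0[unfolded mat_0])

lemma trace_adj: "trace (A\<^sup>\<dagger>) = cnj (trace A)"
  by (simp add: trace_def)

lemma hs_inner_eq: "hs_inner A B = (\<Sum>i\<in>UNIV. \<Sum>j\<in>UNIV. cnj (A $ i $ j) * B $ i $ j)"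
  unfolding hs_inner_def trace_def matrix_matrix_mult_def
  by (simp, rule sum.swap)

lemma Re_hs_inner: "Re (hs_inner A B) = A \<bullet> B"
  by (simp add: hs_inner_eq inner_vec_def inner_complex_def)

lemma of_real_op_scale: "of_real c *\<^sub>o A = c *\<^sub>R A"
  by (simp add: vec_eq_iff scaleR_conv_of_real[symmetric])

interpretation hs: complex_inner_product "op_scale :: complex \<Rightarrow> 'n::finite cop \<Rightarrow> _" hs_inner
proof unfold_locales
  fix A B C :: "'n cop" and c :: complex
  show "hs_inner A (B + C) = hs_inner A B + hs_inner A C"
    by (simp add: hs_inner_eq distrib_left sum.distrib)
  show "hs_inner A (c *\<^sub>o B) = c * hs_inner A B"
    by (simp add: hs_inner_eq sum_distrib_left mult.left_commute)
  show "hs_inner B A = cnj (hs_inner A B)"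
    by (simp add: hs_inner_eq mult.commute)
  show "0 < Re (hs_inner A A)" if "A \<noteq> 0"
    using that by (simp add: Re_hs_inner)
qed

interpretation vec_ip: complex_inner_product "(*s) :: complex \<Rightarrow> complex ^ 'n::finite \<Rightarrow> _" cinner
proof unfold_locales
  fix x y z :: "complex ^ 'n" and c :: complex
  show "cinner x (y + z) = cinner x y + cinner x z"
    by (simp add: cinner_def distrib_left sum.distrib)
  show "cinner x (c *s y) = c * cinner x y"
    by (simp add: cinner_def sum_distrib_left mult.left_commute)
  show "cinner y x = cnj (cinner x y)"
    by (simp add: cinner_def mult.commute)
  have "Re (cinner x x) = x \<bullet> x"
    by (simp add: cinner_def inner_vec_def inner_complex_def)
  then show "0 < Re (cinner x x)" if "x \<noteq> 0"
    using that by simp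
qed

lemma hs_orthonormal_basis_iff:
  "hs_orthonormal_basis V B \<longleftrightarrow> finite B \<and> hs.orthonormal B \<and> cop.span B = V"
  by (auto simp: hs_orthonormal_basis_def hs.orthonormal_def)

lemma hs_inner_adj_adj: "hs_inner (A\<^sup>\<dagger>) (B\<^sup>\<dagger>) = hs_inner B A"
  unfolding hs_inner_def by (simp, rule trace_mul_sym)

text \<open>Finite spanning sets come from the real dimension of the ambient space.\<close>

lemma finite_spanning_set:
  fixes scale :: "complex \<Rightarrow> 'a::euclidean_space \<Rightarrow> 'a"
  assumes "module scale" and V: "module.subspace scale V"
    and scale: "\<And>c x. scale (of_real c) x = c *\<^sub>R x"
  shows "\<exists>S. finite S \<and> module.span scale S = V"
proof -
  interpret module scale by fact
  obtain S where S: "S \<subseteq> V" "Real_Vector_Spaces.independent S" "V \<subseteq> real_vector.span S"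
    using real_vector.basis_exists by metis
  \<comment> \<open>A complex span is also closed under real scalars, so it contains the real span
    of \<open>S\<close> and therefore all of \<open>V\<close>.\<close>
  have "real_vector.subspace (span S)"
    unfolding real_vector.subspace_def
    by (simp add: subspace_0 subspace_add subspace_scale flip: scale)
  then have "real_vector.span S \<subseteq> span S"
    by (intro real_vector.span_minimal span_superset)
  with S have "span S = V"
    using span_minimal[OF S(1) V] by blast
  with S(2) show ?thesis
    using Linear_Algebra.independent_imp_finite by blast
qed

lemma hs_orthonormal_basis_exists:
  fixes V :: "'n::finite cop set"
  assumes "cop.subspace V"
  shows "\<exists>B. hs_orthonormal_basis V B"
proof -
  have "\<exists>S. finite S \<and> cop.span S = V"
    using assms by (intro finite_spanning_set of_real_op_scale cop.module_axioms)
  then show ?thesis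
    using hs.Gram_Schmidt unfolding hs_orthonormal_basis_iff by blast
qed

lemma vec_orthonormal_basis_exists:
  fixes C :: "(complex ^ 'n::finite) set"
  assumes "vec.subspace C"
  shows "\<exists>B. finite B \<and> vec_ip.orthonormal B \<and> vec.span B = C"
proof -
  have scale: "of_real c *s x = c *\<^sub>R x" for c and x :: "complex ^ 'n"
    by (simp add: vec_eq_iff scaleR_conv_of_real[symmetric])
  have "\<exists>S. finite S \<and> vec.span S = C"
    using assms scale by (intro finite_spanning_set vec.module_axioms)
  then show ?thesis
    using vec_ip.Gram_Schmidt by blast
qed


section \<open>The projection onto a code\<close>

text \<open>Resolves the definite description in \<open>code_proj\<close>: at each \<open>x\<close>,
  two candidate values differ by a vector of \<open>C\<close> that is orthogonal to
  \<open>C\<close>.\<close>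

lemma code_proj_eqI:
  assumes "vec.subspace C"
    and P: "\<And>x. P *v x \<in> C" "\<And>x y. y \<in> C \<Longrightarrow> cinner y (x - P *v x) = 0"
  shows "code_proj C = P"
  unfolding code_proj_def
proof (rule the_equality)
  fix Q assume Q: "\<forall>x. Q *v x \<in> C \<and> (\<forall>y\<in>C. cinner y (x - Q *v x) = 0)"
  have "Q *v x = P *v x" for x
  proof -
    let ?d = "Q *v x - P *v x"
    have "?d \<in> C"
      using assms Q by (simp add: vec.subspace_diff)
    then have "cinner ?d (x - P *v x) - cinner ?d (x - Q *v x) = 0"
      using P Q by simp
    then have "cinner ?d ?d = 0"
      by (simp add: flip: vec_ip.ip_diff_right)
    then show ?thesis
      by simp
  qed
  then show "Q = P"
    by (simp add: matrix_eq)
qed (use P in auto)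

lemma code_proj_props:
  fixes C :: "(complex ^ 'n::finite) set"
  assumes C: "vec.subspace C"
  shows "code_proj C ** code_proj C = code_proj C"
    and "(code_proj C)\<^sup>\<dagger> = code_proj C"
    and "trace (code_proj C) = of_nat (vec.dim C)"
proof -
  obtain B where B: "finite B" "vec_ip.orthonormal B" "vec.span B = C"
    using vec_orthonormal_basis_exists[OF C] by blast
  \<comment> \<open>The sum of the rank-one projections onto the lines of an orthonormal basis of
    \<open>C\<close>.\<close>
  define P :: "'n cop" where "P = (\<chi> i j. \<Sum>b\<in>B. b $ i * cnj (b $ j))"
  have Pv: "P *v x = vec_ip.expansion B x" for x
  proof -
    have "(P *v x) $ i = vec_ip.expansion B x $ i" for i
    proof -
      have "(P *v x) $ i = (\<Sum>j\<in>UNIV. \<Sum>b\<in>B. cnj (b $ j) * x $ j * b $ i)"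
        by (simp add: P_def matrix_vector_mult_def sum_distrib_left sum_distrib_right mult_ac)
      also have "\<dots> = vec_ip.expansion B x $ i"
        by (subst sum.swap) (simp add: vec_ip.expansion_def cinner_def sum_distrib_right)
      finally show ?thesis .
    qed
    then show ?thesis
      by (simp add: vec_eq_iff)
  qed
  have CP: "code_proj C = P"
    using C B vec_ip.expansion_in_span[OF B(1,2)] vec_ip.ip_expansion_residue[OF B(1,2)]
    by (intro code_proj_eqI) (simp_all add: Pv)
  have "P *v (P *v x) = P *v x" for x
    unfolding Pv by (intro vec_ip.expansion_span vec_ip.expansion_in_span B)
  then show "code_proj C ** code_proj C = code_proj C"
    by (simp add: CP matrix_eq matrix_vector_mul_assoc[symmetric])
  show "(code_proj C)\<^sup>\<dagger> = code_proj C"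
    by (simp add: CP P_def vec_eq_iff mult.commute)
  have "trace P = (\<Sum>b\<in>B. cinner b b)"
    unfolding trace_def P_def cinner_def
    by (simp add: mult.commute, rule sum.swap)
  also have "\<dots> = of_nat (card B)"
    using B(2) by (simp add: vec_ip.orthonormal_def)
  also have "card B = vec.dim C"
    using vec.dim_span_eq_card_independent[OF vec_ip.orthonormal_independent[OF B(1,2)]] B(3)
    by simp
  finally show "trace (code_proj C) = of_nat (vec.dim C)"
    by (simp add: CP)
qed

lemma code_proj_trivial:
  fixes C :: "(complex ^ 'n::finite) set"
  assumes "vec.subspace C" "vec.dim C = 0"
  shows "code_proj C = 0"
proof -
  have "hs_inner (code_proj C) (code_proj C) = 0"
    using code_proj_props[OF assms(1)] assms(2) by (simp add: hs_inner_def)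
  then show ?thesis
    by simp
qed

text \<open>The zero code has projection 0 and so detects everything at every level; no largest
  level exists, and \<open>has_distance\<close> fails. This permits division by \<open>K\<close>
  later.\<close>

lemma quantum_code_dim_pos:
  assumes "quantum_code \<E> C K d"
  shows "0 < K"
proof (rule ccontr)
  assume "\<not> 0 < K"
  then have "code_proj C = 0"
    using assms by (intro code_proj_trivial) (auto simp: quantum_code_def)
  then have "detects C A" for A
    by (simp add: detects_def)
  then have "detects_below \<E> C (Suc d)"
    by (simp add: detects_below_def)
  then show False
    using assms by (fastforce simp: quantum_code_def has_distance_def)
qed

section \<open>The orthogonal decomposition into sphere spaces\<close>

lemma op_power_subspace: "cop.subspace (op_power \<E> k)"
  by (simp add: op_power_def)

text \<open>At \<open>t = 0\<close> the two definitions meet because the only product of length 0 is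
  the identity.\<close>

lemma graph_metric_of_nat: "graph_metric \<E> (real t) = op_power \<E> t"
proof (cases "t = 0")
  case True
  have "{foldr (**) As (mat 1) | As. length As = 0 \<and> set As \<subseteq> \<E>} = {mat 1}"
    by auto
  with True show ?thesis
    by (simp add: graph_metric_def op_power_def)
qed (simp add: graph_metric_def)

lemma sphere_space_Suc:
  "sphere_space \<E> (Suc t) = op_power \<E> (Suc t) \<inter> hs_perp (op_power \<E> t)"
  using graph_metric_of_nat[of \<E> "Suc t"] graph_metric_of_nat[of \<E> t]
  by (simp add: sphere_space_def)

lemma sphere_space_0: "sphere_space \<E> 0 = op_power \<E> 0"
  using graph_metric_of_nat[of \<E> 0] by (simp add: sphere_space_def graph_metric_def)

lemma sphere_space_subset: "sphere_space \<E> t \<subseteq> op_power \<E> t"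
  by (cases t) (simp_all add: sphere_space_0 sphere_space_Suc)

lemma hs_perp_subspace: "cop.subspace (hs_perp S)"
  unfolding cop.subspace_def hs_perp_def by (auto simp: hs.ip_add_right hs.ip_scale_right)

lemma sphere_space_subspace: "cop.subspace (sphere_space \<E> t)"
  by (cases t)
    (simp_all add: sphere_space_0 sphere_space_Suc op_power_subspace hs_perp_subspace cop.subspace_inter)

text \<open>A product of \<open>k\<close> factors becomes one of \<open>Suc k\<close> factors by
  prepending the identity, which belongs to \<open>\<E>\<close>.\<close>

lemma op_power_Suc_mono:
  assumes "quantum_graph \<E>"
  shows "op_power \<E> k \<subseteq> op_power \<E> (Suc k)"
  unfolding op_power_def
proof (rule cop.span_mono, safe)
  fix As assume "set As \<subseteq> \<E>" "k = length As"
  then show "\<exists>As'. foldr (**) As (mat 1) = foldr (**) As' (mat 1)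
      \<and> length As' = Suc (length As) \<and> set As' \<subseteq> \<E>"
    using assms by (intro exI[of _ "mat 1 # As"]) (auto simp: quantum_graph_def)
qed

lemma op_power_mono:
  assumes "quantum_graph \<E>" "i \<le> j"
  shows "op_power \<E> i \<subseteq> op_power \<E> j"
  using assms(2) by (rule lift_Suc_mono_le[of "op_power \<E>", OF op_power_Suc_mono[OF assms(1)]])

lemma op_power_diameter:
  assumes "metric_connected \<E>"
  shows "op_power \<E> (metric_diameter \<E>) = UNIV"
proof -
  obtain r where "r \<ge> 0" "graph_metric \<E> r = UNIV"
    using assms by (auto simp: metric_connected_def)
  \<comment> \<open>The metric is constant between consecutive integers, so a real witness can be
    rounded down to a natural number, as \<open>LEAST\<close> requires.\<close>
  then have "graph_metric \<E> (real (nat \<lfloor>r\<rfloor>)) = UNIV"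
    by (auto simp: graph_metric_def split: if_splits)
  then have "graph_metric \<E> (real (metric_diameter \<E>)) = UNIV"
    unfolding metric_diameter_def by (rule LeastI)
  then show ?thesis
    by (simp add: graph_metric_of_nat)
qed

section \<open>Adjoint invariance and mutual orthogonality of the sphere spaces\<close>

lemma foldr_mult_append:
  "foldr (**) (As @ Bs) (mat 1 :: 'n::finite cop) = foldr (**) As (mat 1) ** foldr (**) Bs (mat 1)"
  by (induction As) (simp_all add: matrix_mul_assoc)

lemma adj_foldr:
  "(foldr (**) As (mat 1 :: 'n::finite cop))\<^sup>\<dagger> = foldr (**) (rev (map adj As)) (mat 1)"
  by (induction As) (simp_all add: adj_mult foldr_mult_append del: foldr_append)

lemma op_power_adj:
  assumes "quantum_graph \<E>" "A \<in> op_power \<E> k"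
  shows "A\<^sup>\<dagger> \<in> op_power \<E> k"
  using assms(2) unfolding op_power_def
proof (induction rule: cop.span_induct_alt)
  case base
  then show ?case
    by (simp add: cop.span_zero)
next
  case (step c A B)
  obtain As where As: "A = foldr (**) As (mat 1)" "length As = k" "set As \<subseteq> \<E>"
    using step by blast
  \<comment> \<open>Taking adjoints reverses the order of the factors but keeps their number, and
    \<open>\<E>\<close> is closed under adjoints.\<close>
  have "A\<^sup>\<dagger> \<in> {foldr (**) As (mat 1) |As. length As = k \<and> set As \<subseteq> \<E>}"
    using As assms(1) unfolding As(1) adj_foldr quantum_graph_def
    by (intro CollectI exI[of _ "rev (map adj As)"]) auto
  then show ?case
    unfolding adj_add adj_scale by (intro cop.span_add cop.span_scale step) (rule cop.span_base)
qed

text \<open>The adjoint preserves the powers of \<open>\<E>\<close> and conjugates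
  \<open>hs_inner\<close>, so it also preserves their orthogonal complements.\<close>

lemma sphere_space_adj:
  assumes "quantum_graph \<E>" "A \<in> sphere_space \<E> t"
  shows "A\<^sup>\<dagger> \<in> sphere_space \<E> t"
proof (cases t)
  case 0
  then show ?thesis
    using assms op_power_adj by (simp add: sphere_space_0)
next
  case (Suc k)
  have "hs_inner B (A\<^sup>\<dagger>) = 0" if "B \<in> op_power \<E> k" for B
  proof -
    have "hs_inner (B\<^sup>\<dagger>) A = 0"
      using assms op_power_adj[OF assms(1) that] by (simp add: Suc sphere_space_Suc hs_perp_def)
    then show ?thesis
      using hs_inner_adj_adj[of "B\<^sup>\<dagger>" A] hs.ip_commute[of A "B\<^sup>\<dagger>"] by simp
  qed
  then show ?thesis
    using assms op_power_adj unfolding Suc sphere_space_Suc hs_perp_def by blast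
qed

text \<open>For \<open>i < j\<close> the space of index \<open>i\<close> lies in the power
  \<open>j - 1\<close>, to which the space of index \<open>j\<close> is orthogonal by definition;
  conjugate symmetry covers the other order.\<close>

lemma sphere_space_orthogonal:
  assumes "quantum_graph \<E>" "A \<in> sphere_space \<E> i" "B \<in> sphere_space \<E> j" "i \<noteq> j"
  shows "hs_inner A B = 0"
proof -
  have *: "hs_inner A B = 0"
    if "A \<in> sphere_space \<E> i" "B \<in> sphere_space \<E> j" "i < j" for A B i j
  proof -
    obtain k where k: "j = Suc k" "i \<le> k"
      using \<open>i < j\<close> by (cases j) auto
    then have "A \<in> op_power \<E> k"
      using that sphere_space_subset op_power_mono[OF assms(1)] by blast
    then show ?thesis
      using that by (simp add: k sphere_space_Suc hs_perp_def)
  qed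
  show ?thesis
  proof (cases "i < j")
    case False
    then show ?thesis
      using *[OF assms(3,2)] assms(4) hs.ip_commute[of A B] by simp
  qed (use * assms in blast)
qed

section \<open>Orthogonal projections onto the sphere spaces\<close>

lemma sphere_basis: "hs_orthonormal_basis (sphere_space \<E> t) (sphere_basis \<E> t)"
  unfolding sphere_basis_def
  by (rule someI_ex) (rule hs_orthonormal_basis_exists[OF sphere_space_subspace])

lemma sphere_basis_props:
  "finite (sphere_basis \<E> t)" "hs.orthonormal (sphere_basis \<E> t)"
  "cop.span (sphere_basis \<E> t) = sphere_space \<E> t"
  using sphere_basis[of \<E> t] by (simp_all add: hs_orthonormal_basis_iff)

lemma sphere_basis_subset: "A \<in> sphere_basis \<E> t \<Longrightarrow> A \<in> sphere_space \<E> t"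
  by (metis cop.span_base sphere_basis_props(3))

lemma Proj_eq_expansion: "Proj \<E> t X = hs.expansion (sphere_basis \<E> t) X"
  by (simp add: Proj_def hs.expansion_def hs_inner_def)

lemma Proj_in: "Proj \<E> t X \<in> sphere_space \<E> t"
  using hs.expansion_in_span[OF sphere_basis_props(1,2)]
  by (simp add: Proj_eq_expansion sphere_basis_props)

lemma Proj_add: "Proj \<E> t (X + Y) = Proj \<E> t X + Proj \<E> t Y"
  by (simp add: Proj_eq_expansion hs.expansion_def hs.ip_add_right cop.scale_left_distrib sum.distrib)

lemma Proj_fixes: "X \<in> sphere_space \<E> t \<Longrightarrow> Proj \<E> t X = X"
  using hs.expansion_span[OF sphere_basis_props(1,2)]
  by (simp add: Proj_eq_expansion sphere_basis_props)

lemma Proj_orthogonal: "(\<And>A. A \<in> sphere_space \<E> t \<Longrightarrow> hs_inner A X = 0) \<Longrightarrow> Proj \<E> t X = 0"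
  by (simp add: Proj_eq_expansion hs.expansion_def sphere_basis_subset)

lemma Proj_other:
  "quantum_graph \<E> \<Longrightarrow> X \<in> sphere_space \<E> i \<Longrightarrow> i \<noteq> j \<Longrightarrow> Proj \<E> j X = 0"
  by (rule Proj_orthogonal) (use sphere_space_orthogonal in metis)

text \<open>Split \<open>X\<close> into its projection \<open>p\<close> onto the power
  \<open>k\<close> and the residue \<open>q\<close>, which lies in the sphere space of index
  \<open>Suc k\<close>. The projections up to \<open>k\<close> recover \<open>p\<close> and
  annihilate \<open>q\<close>; the last one does the opposite.\<close>

lemma sum_Proj_op_power:
  assumes "quantum_graph \<E>"
  shows "X \<in> op_power \<E> k \<Longrightarrow> (\<Sum>j\<le>k. Proj \<E> j X) = X"
proof (induction k arbitrary: X)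
  case 0
  then show ?case
    by (simp add: Proj_fixes sphere_space_0)
next
  case (Suc k)
  obtain B where B: "finite B" "hs.orthonormal B" "cop.span B = op_power \<E> k"
    using hs_orthonormal_basis_exists[OF op_power_subspace] by (metis hs_orthonormal_basis_iff)
  define p where "p = hs.expansion B X"
  define q where "q = X - p"
  have X: "X = p + q"
    by (simp add: q_def)
  have p: "p \<in> op_power \<E> k"
    using hs.expansion_in_span[OF B(1,2)] by (simp add: p_def B(3))
  have q_perp: "hs_inner A q = 0" if "A \<in> op_power \<E> k" for A
    using hs.ip_expansion_residue[OF B(1,2)] that by (simp add: p_def q_def B(3))
  have "q \<in> op_power \<E> (Suc k)"
    unfolding q_def using Suc.prems p op_power_Suc_mono[OF assms]
    by (intro cop.subspace_diff op_power_subspace) auto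
  with q_perp have q: "q \<in> sphere_space \<E> (Suc k)"
    by (simp add: sphere_space_Suc hs_perp_def)
  have "Proj \<E> (Suc k) p = 0"
  proof (rule Proj_orthogonal)
    fix A assume "A \<in> sphere_space \<E> (Suc k)"
    then show "hs_inner A p = 0"
      using p hs.ip_commute[of A p] by (simp add: sphere_space_Suc hs_perp_def)
  qed
  moreover have "Proj \<E> j q = 0" if "j \<le> k" for j
    using Proj_other[OF assms q] that by simp
  ultimately show ?case
    using Suc.IH[OF p] Proj_fixes[OF q] by (simp add: X Proj_add)
qed

lemma sum_Proj:
  "quantum_graph \<E> \<Longrightarrow> metric_connected \<E> \<Longrightarrow> (\<Sum>j\<le>metric_diameter \<E>. Proj \<E> j X) = X"
  by (simp add: sum_Proj_op_power op_power_diameter)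


section \<open>The maps \<open>\<Phi>\<^sub>t\<close>\<close>

text \<open>Expand each \<open>A\<close> of \<open>B\<close> in the basis \<open>B'\<close>. After
  summing over \<open>A\<close>, Parseval turns the coefficient of
  \<open>F ** X ** F'\<^sup>\<dagger>\<close> into \<open>hs_inner F F'\<close>, which is 1 on the
  diagonal and 0 elsewhere.\<close>

lemma sum_sandwich_basis_indep:
  assumes "hs_orthonormal_basis V B" "hs_orthonormal_basis V B'"
  shows "(\<Sum>A\<in>B. A ** X ** A\<^sup>\<dagger>) = (\<Sum>A\<in>B'. A ** X ** A\<^sup>\<dagger>)"
proof -
  have B: "finite B" "hs.orthonormal B" "cop.span B = V"
    and B': "finite B'" "hs.orthonormal B'" "cop.span B' = V"
    using assms by (simp_all add: hs_orthonormal_basis_iff)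
  have exp: "A ** X ** A\<^sup>\<dagger>
      = (\<Sum>F\<in>B'. \<Sum>F'\<in>B'. (hs_inner F A * hs_inner A F') *\<^sub>o (F ** X ** F'\<^sup>\<dagger>))"
    if "A \<in> B" for A
  proof -
    have A: "A = (\<Sum>F\<in>B'. hs_inner F A *\<^sub>o F)"
      using hs.expansion_span[OF B'(1,2)] cop.span_base[OF that] B(3) B'(3)
      by (simp add: hs.expansion_def)
    have A': "A\<^sup>\<dagger> = (\<Sum>F\<in>B'. hs_inner A F *\<^sub>o F\<^sup>\<dagger>)"
      by (subst A) (simp add: adj_sum adj_scale hs.ip_commute[of A])
    have "A ** X ** A\<^sup>\<dagger> = (\<Sum>F\<in>B'. hs_inner F A *\<^sub>o F) ** X ** (\<Sum>F\<in>B'. hs_inner A F *\<^sub>o F\<^sup>\<dagger>)"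
      using A A' by simp
    also have "\<dots> = (\<Sum>F'\<in>B'. \<Sum>F\<in>B'. (hs_inner F A * hs_inner A F') *\<^sub>o (F ** X ** F'\<^sup>\<dagger>))"
      by (simp only: matrix_sum_mult matrix_mult_sum op_scale_mult_left op_scale_mult_right
          cop.scale_sum_right cop.scale_scale mult.commute)
    finally show ?thesis
      by (subst sum.swap)
  qed
  have "(\<Sum>A\<in>B. A ** X ** A\<^sup>\<dagger>)
      = (\<Sum>A\<in>B. \<Sum>F\<in>B'. \<Sum>F'\<in>B'. (hs_inner F A * hs_inner A F') *\<^sub>o (F ** X ** F'\<^sup>\<dagger>))"
    by (intro sum.cong exp) simp_all
  also have "\<dots> = (\<Sum>F\<in>B'. \<Sum>F'\<in>B'. \<Sum>A\<in>B. (hs_inner F A * hs_inner A F') *\<^sub>o (F ** X ** F'\<^sup>\<dagger>))"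
    by (rule trans[OF sum.swap]) (intro sum.cong refl sum.swap)
  also have "\<dots> = (\<Sum>F\<in>B'. \<Sum>F'\<in>B'. hs_inner F F' *\<^sub>o (F ** X ** F'\<^sup>\<dagger>))"
  proof (intro sum.cong refl)
    fix F F' assume "F' \<in> B'"
    then have "(\<Sum>A\<in>B. hs_inner F A * hs_inner A F') = hs_inner F F'"
      using cop.span_base[of F' B'] by (intro hs.Parseval_ip B) (simp add: B(3) B'(3))
    then show "(\<Sum>A\<in>B. (hs_inner F A * hs_inner A F') *\<^sub>o (F ** X ** F'\<^sup>\<dagger>))
        = hs_inner F F' *\<^sub>o (F ** X ** F'\<^sup>\<dagger>)"
      by (simp flip: cop.scale_sum_left)
  qed
  also have "\<dots> = (\<Sum>F\<in>B'. \<Sum>F'\<in>B'. if F = F' then F ** X ** F\<^sup>\<dagger> else 0)"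
    using B'(2) unfolding hs.orthonormal_def by (intro sum.cong refl) auto
  also have "\<dots> = (\<Sum>F\<in>B'. F ** X ** F\<^sup>\<dagger>)"
    using B'(1) by simp
  finally show ?thesis .
qed

section \<open>Linearity, equivariance and symmetry of \<open>Phi\<close>\<close>

abbreviation op_linear :: "('n::finite cop \<Rightarrow> 'n cop) \<Rightarrow> bool"
  where "op_linear \<equiv> Vector_Spaces.linear op_scale op_scale"

lemma op_linearI:
  assumes "\<And>A B. f (A + B) = f A + f B" "\<And>c A. f (c *\<^sub>o A) = c *\<^sub>o f A"
  shows "op_linear f"
  unfolding Vector_Spaces.linear_def module_hom_def module_hom_axioms_def
  using assms cop.vector_space_axioms cop.module_axioms by blast

lemma op_linearD:
  assumes "op_linear f"
  shows "f (A + B) = f A + f B" "f (c *\<^sub>o A) = c *\<^sub>o f A" "f 0 = 0" "f (A - B) = f A - f B"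
proof -
  interpret Vector_Spaces.linear op_scale op_scale f by fact
  show "f (A + B) = f A + f B" "f (c *\<^sub>o A) = c *\<^sub>o f A" "f 0 = 0" "f (A - B) = f A - f B"
    by (rule add scale zero diff)+
qed

lemma op_linear_conj: "op_linear (\<lambda>A. U ** A ** V)"
  by (rule op_linearI)
    (simp_all add: matrix_add_ldistrib matrix_add_mult op_scale_mult_left op_scale_mult_right)

lemma Phi_linear: "op_linear (Phi \<E> t)"
  unfolding Phi_def
  by (rule op_linearI)
    (simp_all add: op_linearD[OF op_linear_conj] sum.distrib cop.scale_sum_right)

lemma Phi_eq_sum_basis:
  "hs_orthonormal_basis (sphere_space \<E> t) B \<Longrightarrow> Phi \<E> t X = (\<Sum>A\<in>B. A ** X ** A\<^sup>\<dagger>)"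
  unfolding Phi_def by (rule sum_sandwich_basis_indep[OF sphere_basis])

lemma hs_inner_conj_unitary:
  assumes "U\<^sup>\<dagger> ** U = mat 1"
  shows "hs_inner (U ** A ** U\<^sup>\<dagger>) (U ** B ** U\<^sup>\<dagger>) = hs_inner A B"
proof -
  have "(U ** A ** U\<^sup>\<dagger>)\<^sup>\<dagger> ** (U ** B ** U\<^sup>\<dagger>) = U ** (A\<^sup>\<dagger> ** (U\<^sup>\<dagger> ** U) ** B ** U\<^sup>\<dagger>)"
    by (simp add: adj_mult matrix_mul_assoc)
  also have "\<dots> = U ** (A\<^sup>\<dagger> ** B ** U\<^sup>\<dagger>)"
    by (simp add: assms)
  finally have "hs_inner (U ** A ** U\<^sup>\<dagger>) (U ** B ** U\<^sup>\<dagger>) = trace (A\<^sup>\<dagger> ** B ** U\<^sup>\<dagger> ** U)"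
    by (simp add: hs_inner_def trace_mul_sym[of U])
  also have "A\<^sup>\<dagger> ** B ** U\<^sup>\<dagger> ** U = A\<^sup>\<dagger> ** B"
    by (metis assms matrix_mul_assoc matrix_mul_rid)
  finally show ?thesis
    by (simp add: hs_inner_def)
qed

text \<open>Conjugation by \<open>U\<close> carries the chosen orthonormal basis to another one of
  the same space, so \<open>Phi\<close> may be computed with the transformed basis; the inner
  factors \<open>U\<^sup>\<dagger> ** U\<close> then cancel.\<close>

lemma Phi_conj_unitary:
  assumes U: "U\<^sup>\<dagger> ** U = mat 1"
    and V: "(\<lambda>A. U ** A ** U\<^sup>\<dagger>) ` sphere_space \<E> t = sphere_space \<E> t"
  shows "Phi \<E> t (U ** X ** U\<^sup>\<dagger>) = U ** Phi \<E> t X ** U\<^sup>\<dagger>"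
proof -
  let ?c = "\<lambda>A. U ** A ** U\<^sup>\<dagger>" and ?B = "sphere_basis \<E> t"
  have cancel: "U\<^sup>\<dagger> ** (U ** A) = A" for A
    by (metis U matrix_mul_assoc matrix_mul_lid)
  have cc: "U\<^sup>\<dagger> ** ?c A ** U = A" for A
    using cancel U by (simp add: matrix_mul_assoc[symmetric])
  have inj: "inj ?c"
    by (rule inj_on_inverseI) (rule cc)
  then have c_eq: "?c A = ?c B \<longleftrightarrow> A = B" for A B
    by (auto dest: injD)
  interpret c: Vector_Spaces.linear op_scale op_scale ?c
    by (rule op_linear_conj)
  have "cop.span (?c ` ?B) = sphere_space \<E> t"
    using c.span_image[of ?B] V sphere_basis_props(3)[of \<E> t] by simp
  then have "hs_orthonormal_basis (sphere_space \<E> t) (?c ` ?B)"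
    using sphere_basis_props(1,2)[of \<E> t] inj
    by (simp add: hs_orthonormal_basis_iff hs.orthonormal_def hs_inner_conj_unitary[OF U] c_eq)
  then have "Phi \<E> t (?c X) = (\<Sum>A\<in>?B. ?c A ** ?c X ** (?c A)\<^sup>\<dagger>)"
    using inj by (simp add: Phi_eq_sum_basis sum.reindex inj_on_subset)
  also have "\<dots> = (\<Sum>A\<in>?B. ?c (A ** X ** A\<^sup>\<dagger>))"
    by (intro sum.cong refl) (simp only: adj_mult adj_adj cancel matrix_mul_assoc[symmetric])
  also have "\<dots> = ?c (Phi \<E> t X)"
    by (simp add: Phi_def c.sum)
  finally show ?thesis .
qed

lemma adj_eq_iff: "A\<^sup>\<dagger> = B\<^sup>\<dagger> \<longleftrightarrow> A = B"
  by (metis adj_adj)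

text \<open>The adjoint is only conjugate linear, so the span of the image is found by a direct
  induction instead of through the image of a span under a linear map.\<close>

lemma hs_orthonormal_basis_adj:
  assumes V: "\<And>A. A \<in> V \<Longrightarrow> A\<^sup>\<dagger> \<in> V" and B: "hs_orthonormal_basis V B"
  shows "hs_orthonormal_basis V (adj ` B)"
proof -
  have span: "cop.span B = V"
    using B by (simp add: hs_orthonormal_basis_def)
  have "A\<^sup>\<dagger> \<in> cop.span (adj ` B)" if "A \<in> V" for A
    using that unfolding span[symmetric]
  proof (induction rule: cop.span_induct_alt)
    case (step c x y)
    then show ?case
      by (auto simp: adj_add adj_scale intro!: cop.span_add cop.span_scale intro: cop.span_base)
  qed (simp add: cop.span_zero)
  then have "V \<subseteq> cop.span (adj ` B)"
    using V by (metis adj_adj subsetI)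
  moreover have "cop.span (adj ` B) \<subseteq> V"
    using V span by (intro cop.span_minimal) (auto simp: cop.span_base)
  moreover have "hs.orthonormal (adj ` B)"
    using B by (auto simp: hs_orthonormal_basis_iff hs.orthonormal_def hs_inner_adj_adj adj_eq_iff)
  ultimately show ?thesis
    using B by (simp add: hs_orthonormal_basis_iff)
qed

text \<open>The adjoint superoperator sends \<open>X\<close> to \<open>\<Sum> E\<^sup>* X E\<close>, the sum over the adjoint basis.\<close>

lemma Phi_symmetric:
  assumes "quantum_graph \<E>"
  shows "hs_inner (Phi \<E> t X) Y = hs_inner X (Phi \<E> t Y)"
proof -
  have "hs_inner (Phi \<E> t X) Y = (\<Sum>A\<in>sphere_basis \<E> t. trace (A ** X\<^sup>\<dagger> ** A\<^sup>\<dagger> ** Y))"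
    by (simp add: hs_inner_def Phi_def adj_sum adj_mult matrix_sum_mult trace_sum matrix_mul_assoc)
  also have "\<dots> = (\<Sum>A\<in>sphere_basis \<E> t. trace (X\<^sup>\<dagger> ** (A\<^sup>\<dagger> ** Y ** A)))"
    by (intro sum.cong refl) (metis matrix_mul_assoc trace_mul_sym)
  also have "\<dots> = hs_inner X (\<Sum>A\<in>sphere_basis \<E> t. A\<^sup>\<dagger> ** Y ** (A\<^sup>\<dagger>)\<^sup>\<dagger>)"
    by (simp add: hs_inner_def matrix_mult_sum trace_sum)
  also have "(\<Sum>A\<in>sphere_basis \<E> t. A\<^sup>\<dagger> ** Y ** (A\<^sup>\<dagger>)\<^sup>\<dagger>) = (\<Sum>A\<in>adj ` sphere_basis \<E> t. A ** Y ** A\<^sup>\<dagger>)"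
    by (subst sum.reindex) (auto intro!: inj_on_inverseI[of _ adj])
  also have "\<dots> = Phi \<E> t Y"
    using sphere_space_adj[OF assms]
    by (intro Phi_eq_sum_basis[symmetric] hs_orthonormal_basis_adj sphere_basis)
  finally show ?thesis .
qed

section \<open>Schur's lemma in the multiplicity-free case\<close>

definition equivariant :: "('g, 'm) monoid_scheme \<Rightarrow> ('g \<Rightarrow> 'n::finite cop) \<Rightarrow> ('n cop \<Rightarrow> 'n cop) \<Rightarrow> bool"
  where "equivariant G R f \<longleftrightarrow> (\<forall>g\<in>carrier G. \<forall>A. f (conj_act R g A) = conj_act R g (f A))"

lemma equivariant_comp: "equivariant G R f \<Longrightarrow> equivariant G R g \<Longrightarrow> equivariant G R (\<lambda>A. f (g A))"
  by (simp add: equivariant_def)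

lemma op_linear_comp: "op_linear f \<Longrightarrow> op_linear g \<Longrightarrow> op_linear (\<lambda>A. f (g A))"
  by (rule op_linearI) (simp_all add: op_linearD)

lemma op_linear_conj_act: "op_linear (conj_act R g)"
  unfolding conj_act_def by (rule op_linear_conj)

lemma op_linear_sum: "op_linear f \<Longrightarrow> f (sum h S) = (\<Sum>x\<in>S. f (h x))"
  by (induction S rule: infinite_finite_induct) (simp_all add: op_linearD)

lemma Schur_zero_or_bij:
  assumes V: "irreducible_rep G R V" and W: "irreducible_rep G R W"
    and f: "op_linear f" "equivariant G R f" "f ` V \<subseteq> W"
  shows "(\<forall>A\<in>V. f A = 0) \<or> bij_betw f V W"
proof (rule disjCI)
  assume nb: "\<not> bij_betw f V W"
  have sV: "cop.subspace V" and invV: "\<And>g A. g \<in> carrier G \<Longrightarrow> A \<in> V \<Longrightarrow> conj_act R g A \<in> V"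
    using V by (auto simp: irreducible_rep_def subrep_def)
  note lin = op_linearD[OF f(1)] and conj = op_linearD[OF op_linear_conj_act]
  have "subrep G R {A\<in>V. f A = 0}"
    using f(2) sV invV unfolding subrep_def cop.subspace_def equivariant_def
    by (simp add: lin conj)
  then consider "{A\<in>V. f A = 0} = V" | "{A\<in>V. f A = 0} = {0}"
    using V unfolding irreducible_rep_def by blast
  then show "\<forall>A\<in>V. f A = 0"
  proof cases
    case 2
    have inj: "inj_on f V"
    proof (rule inj_onI)
      fix A B assume "A \<in> V" "B \<in> V" "f A = f B"
      then have "A - B \<in> {A\<in>V. f A = 0}"
        using sV by (simp add: lin cop.subspace_diff)
      then show "A = B"
        using 2 by simp
    qed
    interpret f: Vector_Spaces.linear op_scale op_scale f
      by fact
    have "conj_act R g (f A) \<in> f ` V" if "g \<in> carrier G" "A \<in> V" for g A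
      using that invV f(2) unfolding equivariant_def by (metis imageI)
    then have "subrep G R (f ` V)"
      unfolding subrep_def using f.subspace_image[OF sV] by blast
    then have "f ` V = {0} \<or> f ` V = W"
      using W f(3) unfolding irreducible_rep_def by blast
    then show ?thesis
      using nb inj by (auto simp: bij_betw_def)
  qed blast
qed

text \<open>The isomorphism is \<open>f'\<close> after the inverse of \<open>f\<close>. The inverse
  is taken as a linear map on all operators, the form that \<open>rep_iso\<close> asks for.\<close>

lemma rep_iso_common_source:
  fixes R :: "'g \<Rightarrow> 'n::finite cop"
  assumes V: "subrep G R V"
    and f: "op_linear f" "equivariant G R f" "bij_betw f V W"
    and f': "op_linear f'" "equivariant G R f'" "bij_betw f' V W'"
  shows "rep_iso G R W W'"
proof -
  interpret vector_space_pair "op_scale :: _ \<Rightarrow> 'n cop \<Rightarrow> _" "op_scale :: _ \<Rightarrow> 'n cop \<Rightarrow> _"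
    by unfold_locales
  obtain g where g: "op_linear g" "\<And>A. A \<in> V \<Longrightarrow> g (f A) = A"
    using linear_exists_left_inverse_on[OF f(1), of V] V f(3)
    by (auto simp: subrep_def bij_betw_def)
  have "bij_betw g W V"
    using f(3) g(2) by (intro bij_betw_byWitness[of _ f]) (auto simp: bij_betw_def)
  then have "bij_betw (\<lambda>A. f' (g A)) W W'"
    using bij_betw_trans[OF _ f'(3), of g W] by (simp add: comp_def)
  moreover have "f' (g (conj_act R h A)) = conj_act R h (f' (g A))"
    if h: "h \<in> carrier G" and "A \<in> W" for h A
  proof -
    obtain B where B: "B \<in> V" "A = f B"
      using f(3) \<open>A \<in> W\<close> by (auto simp: bij_betw_def)
    then have "conj_act R h B \<in> V"
      using V h by (simp add: subrep_def)
    moreover have "conj_act R h A = f (conj_act R h B)"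
      using f(2) h by (simp add: B(2) equivariant_def)
    ultimately have "g (conj_act R h A) = conj_act R h (g A)"
      by (simp only: B g(2))
    then show ?thesis
      using f'(2) h by (simp add: equivariant_def)
  qed
  ultimately show ?thesis
    unfolding rep_iso_def using op_linear_comp[OF f'(1) g(1)] by blast
qed

text \<open>Turns the direct sum into its component projections \<open>\<pi>\<close>. Since
  components are unique, any family of members of the summands with the right sum must be the family
  of components; linearity and equivariance both follow by exhibiting such families.\<close>

lemma multiplicity_free_components:
  assumes "multiplicity_free G R"
  obtains \<W> \<pi> where "finite \<W>" "\<And>W. W \<in> \<W> \<Longrightarrow> irreducible_rep G R W"
    "\<And>W W'. W \<in> \<W> \<Longrightarrow> W' \<in> \<W> \<Longrightarrow> W \<noteq> W' \<Longrightarrow> \<not> rep_iso G R W W'"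
    "\<And>W. W \<in> \<W> \<Longrightarrow> op_linear (\<pi> W)" "\<And>W. W \<in> \<W> \<Longrightarrow> equivariant G R (\<pi> W)"
    "\<And>W A. W \<in> \<W> \<Longrightarrow> \<pi> W A \<in> W" "\<And>A. (\<Sum>W\<in>\<W>. \<pi> W A) = A"
proof -
  obtain \<W> where fin: "finite \<W>" and irr: "\<forall>W\<in>\<W>. irreducible_rep G R W"
    and ex1: "\<forall>A. \<exists>!f. f \<in> (\<Pi>\<^sub>E W\<in>\<W>. W) \<and> A = (\<Sum>W\<in>\<W>. f W)"
    and niso: "\<forall>W\<in>\<W>. \<forall>W'\<in>\<W>. W \<noteq> W' \<longrightarrow> \<not> rep_iso G R W W'"
    using assms[unfolded multiplicity_free_def] by (elim exE conjE) (rule that; assumption)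
  define F where "F A = (THE f. f \<in> (\<Pi>\<^sub>E W\<in>\<W>. W) \<and> A = (\<Sum>W\<in>\<W>. f W))" for A
  define \<pi> where "\<pi> W A = F A W" for W A
  have F: "F A \<in> (\<Pi>\<^sub>E W\<in>\<W>. W)" "A = (\<Sum>W\<in>\<W>. F A W)" for A
    using theI'[OF ex1[rule_format, of A]] by (simp_all add: F_def)
  have \<pi>_in: "\<pi> W A \<in> W" if "W \<in> \<W>" for W A
    using F(1)[of A] that by (auto simp: \<pi>_def)
  have unique: "\<pi> W A = h W"
    if h: "\<And>W. W \<in> \<W> \<Longrightarrow> h W \<in> W" "A = (\<Sum>W\<in>\<W>. h W)" and "W \<in> \<W>" for h A W
  proof -
    \<comment> \<open>Uniqueness holds among extensional functions, so \<open>h\<close> is first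
      made undefined outside \<open>\<W>\<close>.\<close>
    have "restrict h \<W> \<in> (\<Pi>\<^sub>E W\<in>\<W>. W) \<and> A = (\<Sum>W\<in>\<W>. restrict h \<W> W)"
      using h by auto
    then have "F A = restrict h \<W>"
      unfolding F_def by (rule the1_equality[OF ex1[rule_format, of A]])
    then show ?thesis
      using \<open>W \<in> \<W>\<close> by (simp add: \<pi>_def)
  qed
  have sub: "cop.subspace W" if "W \<in> \<W>" for W
    using irr that by (simp add: irreducible_rep_def subrep_def)
  have sum: "(\<Sum>W\<in>\<W>. \<pi> W A) = A" for A
    using F(2) by (simp add: \<pi>_def)
  have "op_linear (\<pi> W)" if "W \<in> \<W>" for W
  proof (rule op_linearI)
    show "\<pi> W (A + B) = \<pi> W A + \<pi> W B" for A B
      using that by (intro unique[where h = "\<lambda>W. \<pi> W A + \<pi> W B"])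
        (simp_all add: sum.distrib sum cop.subspace_add sub \<pi>_in)
    show "\<pi> W (c *\<^sub>o A) = c *\<^sub>o \<pi> W A" for c A
      using that by (intro unique[where h = "\<lambda>W. c *\<^sub>o \<pi> W A"])
        (simp_all add: sum cop.subspace_scale sub \<pi>_in flip: cop.scale_sum_right)
  qed
  moreover have "equivariant G R (\<pi> W)" if "W \<in> \<W>" for W
    unfolding equivariant_def
  proof (intro ballI allI)
    fix g A assume g: "g \<in> carrier G"
    have inv: "conj_act R g B \<in> W" if "W \<in> \<W>" "B \<in> W" for W B
      using irr that g by (simp add: irreducible_rep_def subrep_def)
    show "\<pi> W (conj_act R g A) = conj_act R g (\<pi> W A)"
      using that by (intro unique[where h = "\<lambda>W. conj_act R g (\<pi> W A)"])
        (simp_all add: inv \<pi>_in sum flip: op_linear_sum[OF op_linear_conj_act])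
  qed
  ultimately show thesis
    using fin irr niso \<pi>_in sum by (intro that[of \<W> \<pi>]) simp_all
qed

text \<open>
  Every irreducible subrepresentation is one of the summands of a multiplicity-free decomposition,
  and an equivariant map cannot mix non-isomorphic summands.
\<close>

lemma multiplicity_free_invariant:
  assumes mf: "multiplicity_free G R" and V: "irreducible_rep G R V"
    and T: "op_linear T" "equivariant G R T" and "A \<in> V"
  shows "T A \<in> V"
proof -
  obtain \<W> \<pi> where fin: "finite \<W>" and irr: "\<And>W. W \<in> \<W> \<Longrightarrow> irreducible_rep G R W"
    and niso: "\<And>W W'. W \<in> \<W> \<Longrightarrow> W' \<in> \<W> \<Longrightarrow> W \<noteq> W' \<Longrightarrow> \<not> rep_iso G R W W'"
    and lin: "\<And>W. W \<in> \<W> \<Longrightarrow> op_linear (\<pi> W)" and eqv: "\<And>W. W \<in> \<W> \<Longrightarrow> equivariant G R (\<pi> W)"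
    and \<pi>_in: "\<And>W A. W \<in> \<W> \<Longrightarrow> \<pi> W A \<in> W" and sum: "\<And>A. (\<Sum>W\<in>\<W>. \<pi> W A) = A"
    by (rule multiplicity_free_components[OF mf]) (rule that; assumption)
  have sV: "subrep G R V" "V \<noteq> {0}" "0 \<in> V"
    using V by (auto simp: irreducible_rep_def subrep_def cop.subspace_0)
  \<comment> \<open>An operator with no component outside \<open>W\<close> equals its
    \<open>W\<close>-component.\<close>
  have single: "B \<in> W" if "W \<in> \<W>" "\<And>W'. W' \<in> \<W> \<Longrightarrow> W' \<noteq> W \<Longrightarrow> \<pi> W' B = 0" for W B
  proof -
    have "B = (\<Sum>W'\<in>\<W>. if W' = W then \<pi> W B else 0)"
      by (subst sum[of B, symmetric], rule sum.cong) (use that in auto)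
    then have "B = \<pi> W B"
      using fin that(1) by simp
    then show ?thesis
      using \<pi>_in[OF that(1)] by metis
  qed
  have bij: "bij_betw (\<pi> W) V W" if "W \<in> \<W>" "B \<in> V" "\<pi> W B \<noteq> 0" for W B
    using Schur_zero_or_bij[OF V irr lin eqv, of W W] \<pi>_in that by blast
  obtain A0 where "A0 \<in> V" "A0 \<noteq> 0"
    using sV by blast
  then obtain W where W: "W \<in> \<W>" "\<pi> W A0 \<noteq> 0"
    using sum[of A0] by (metis sum.neutral)
  \<comment> \<open>Were a second component nonzero on \<open>V\<close>, Schur would make
    \<open>V\<close> isomorphic to two different summands, hence these to each other.\<close>
  have "V \<subseteq> W"
  proof
    fix B assume "B \<in> V"
    show "B \<in> W"
    proof (rule single[OF W(1)], rule ccontr)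
      fix W' assume W': "W' \<in> \<W>" "W' \<noteq> W" "\<pi> W' B \<noteq> 0"
      have "rep_iso G R W W'"
        using bij[OF W(1) \<open>A0 \<in> V\<close> W(2)] bij[OF W'(1) \<open>B \<in> V\<close> W'(3)]
        by (rule rep_iso_common_source[OF sV(1) lin[OF W(1)] eqv[OF W(1)] _
              lin[OF W'(1)] eqv[OF W'(1)]])
      then show False
        using niso W(1) W' by blast
    qed
  qed
  then have "V = W"
    using irr[OF W(1)] sV unfolding irreducible_rep_def by blast
  \<comment> \<open>A nonzero component of \<open>T A\<close> in another summand \<open>W'\<close>
    would give an isomorphism from \<open>V\<close> to \<open>W'\<close>.\<close>
  show ?thesis
    unfolding \<open>V = W\<close>
  proof (rule single[OF W(1)], rule ccontr)
    fix W' assume W': "W' \<in> \<W>" "W' \<noteq> W" "\<pi> W' (T A) \<noteq> 0"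
    have lin': "op_linear (\<lambda>A. \<pi> W' (T A))" and eqv': "equivariant G R (\<lambda>A. \<pi> W' (T A))"
      using op_linear_comp[OF lin T(1)] equivariant_comp[OF eqv T(2)] W'(1) by blast+
    have "bij_betw (\<lambda>A. \<pi> W' (T A)) V W'"
      using Schur_zero_or_bij[OF V irr[OF W'(1)] lin' eqv'] \<pi>_in[OF W'(1)] \<open>A \<in> V\<close> W'(3) by blast
    then have "rep_iso G R V W'"
      using lin' eqv' unfolding rep_iso_def equivariant_def by blast
    then show False
      using niso[OF W(1) W'(1)] W'(2) \<open>V = W\<close> by blast
  qed
qed

section \<open>Eigenvectors of symmetric maps and the scalar form of Schur's lemma\<close>

lemma linear_term_zero:
  fixes a b :: real
  assumes "\<And>t. a * t + b * t\<^sup>2 \<le> 0"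
  shows "a = 0"
proof (rule ccontr)
  assume "a \<noteq> 0"
  \<comment> \<open>This \<open>t\<close> has the sign of \<open>a\<close> and is small enough that
    the linear term dominates; adding 1 keeps the denominator positive when
    \<open>b = 0\<close>.\<close>
  define t where "t = a / (2 * (\<bar>b\<bar> + 1))"
  have "\<bar>b * t\<bar> < \<bar>a\<bar>"
  proof -
    have "\<bar>b\<bar> * \<bar>a\<bar> < \<bar>a\<bar> * (2 * (\<bar>b\<bar> + 1))"
      using \<open>a \<noteq> 0\<close> by (simp add: algebra_simps add_nonneg_pos)
    then show ?thesis
      by (simp add: t_def abs_mult field_simps)
  qed
  then have "a\<^sup>2 + a * (b * t) > 0"
  proof -
    assume "\<bar>b * t\<bar> < \<bar>a\<bar>"
    then have "\<bar>a\<bar> * \<bar>b * t\<bar> < \<bar>a\<bar> * \<bar>a\<bar>"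
      using \<open>a \<noteq> 0\<close> by (intro mult_strict_left_mono) auto
    moreover have "- (a * (b * t)) \<le> \<bar>a\<bar> * \<bar>b * t\<bar>"
      by (metis abs_ge_minus_self abs_mult)
    ultimately show ?thesis
      by (simp add: power2_eq_square)
  qed
  then have "(a\<^sup>2 + a * (b * t)) / (2 * (\<bar>b\<bar> + 1)) > 0"
    by simp
  moreover have "(a\<^sup>2 + a * (b * t)) / (2 * (\<bar>b\<bar> + 1)) = a * t + b * t\<^sup>2"
    by (simp add: t_def power2_eq_square add_divide_distrib del: mult_eq_0_iff)
  ultimately show False
    using assms[of t] by simp
qed

text \<open>A maximiser of the quadratic form of \<open>T\<close> on the unit sphere of \<open>V\<close> is an eigenvector.\<close>

lemma symmetric_eigenvector:
  fixes T :: "'a::euclidean_space \<Rightarrow> 'a"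
  assumes T: "linear T" "\<And>x y. T x \<bullet> y = x \<bullet> T y"
    and V: "subspace V" "V \<noteq> {0}" "\<And>x. x \<in> V \<Longrightarrow> T x \<in> V"
  shows "\<exists>c. \<exists>x\<in>V. x \<noteq> 0 \<and> T x = c *\<^sub>R x"
proof -
  define S where "S = V \<inter> sphere 0 1"
  obtain y where "y \<in> V" "y \<noteq> 0"
    using V(1,2) subspace_0 by blast
  then have "y /\<^sub>R norm y \<in> S"
    using V(1) by (simp add: S_def subspace_scale)
  moreover have "compact S"
    unfolding S_def by (intro closed_Int_compact closed_subspace V(1) compact_sphere)
  moreover have "continuous_on S (\<lambda>x. T x \<bullet> x)"
    using linear_continuous_on[of T] T(1)
    by (intro continuous_intros) (simp add: linear_conv_bounded_linear)
  ultimately obtain x where x: "x \<in> S" and max: "\<And>y. y \<in> S \<Longrightarrow> T y \<bullet> y \<le> T x \<bullet> x"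
    using continuous_attains_sup[of S "\<lambda>x. T x \<bullet> x"] by blast
  define c where "c = T x \<bullet> x"
  have xV: "x \<in> V" and xx: "x \<bullet> x = 1"
    using x by (auto simp: S_def norm_eq_1)
  \<comment> \<open>Maximality on the unit sphere extends to all of \<open>V\<close> by homogeneity
    of degree 2.\<close>
  have bound: "T y \<bullet> y \<le> c * (y \<bullet> y)" if "y \<in> V" for y
  proof (cases "y = 0")
    case False
    then have "y /\<^sub>R norm y \<in> S"
      using V(1) that by (simp add: S_def subspace_scale)
    from max[OF this] have "(T y \<bullet> y) / (norm y)\<^sup>2 \<le> c"
      by (simp add: c_def linear_scale[OF T(1)] power2_eq_square divide_inverse mult_ac)
    then show ?thesis
      using False by (simp add: divide_le_eq power2_norm_eq_inner)
  qed (simp add: linear_0[OF T(1)])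
  define z where "z = T x - c *\<^sub>R x"
  have zV: "z \<in> V"
    unfolding z_def using V xV by (intro subspace_diff subspace_scale) auto
  \<comment> \<open>Perturb the maximizer along the residue \<open>z\<close>. The bound at
    \<open>x + t *\<^sub>R z\<close> is quadratic in \<open>t\<close> with linear coefficient
    \<open>2 * (z \<bullet> z)\<close>, which must vanish.\<close>
  have "2 * (z \<bullet> z) * t + (T z \<bullet> z - c * (z \<bullet> z)) * t\<^sup>2 \<le> 0" for t
  proof -
    have "x + t *\<^sub>R z \<in> V"
      using V(1) xV zV by (intro subspace_add subspace_scale)
    from bound[OF this] have "T x \<bullet> x + 2 * t * (T x \<bullet> z) + t\<^sup>2 * (T z \<bullet> z)
        \<le> c + c * (2 * t * (x \<bullet> z)) + c * (t\<^sup>2 * (z \<bullet> z))"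
      using T(2)[of z x]
      by (simp add: linear_add[OF T(1)] linear_scale[OF T(1)] inner_add_left inner_add_right xx
          inner_commute power2_eq_square algebra_simps)
    moreover have "2 * (z \<bullet> z) * t = 2 * t * (T x \<bullet> z) - c * (2 * t * (x \<bullet> z))"
      by (subst (1) z_def) (simp add: inner_diff_left algebra_simps)
    ultimately have "2 * (z \<bullet> z) * t + t\<^sup>2 * (T z \<bullet> z) - c * (t\<^sup>2 * (z \<bullet> z)) \<le> 0"
      by (simp add: c_def[symmetric])
    then show ?thesis
      by (simp add: algebra_simps)
  qed
  then have "2 * (z \<bullet> z) = 0"
    by (rule linear_term_zero)
  then have "T x = c *\<^sub>R x"
    by (simp add: z_def)
  moreover have "x \<noteq> 0"
    using xx by auto
  ultimately show ?thesis
    using xV by blast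
qed

text \<open>Symmetry supplies a real eigenvalue on \<open>V\<close>. Its eigenspace in
  \<open>V\<close> is a nonzero subrepresentation because \<open>T\<close> is equivariant, so it is
  all of \<open>V\<close>.\<close>

lemma Schur_scalar:
  assumes V: "irreducible_rep G R V"
    and T: "op_linear T" "equivariant G R T" "\<And>A B. hs_inner (T A) B = hs_inner A (T B)"
    and inv: "\<And>A. A \<in> V \<Longrightarrow> T A \<in> V"
  shows "\<exists>c. \<forall>A\<in>V. T A = c *\<^sub>R A"
proof -
  have sV: "cop.subspace V" "V \<noteq> {0}" "\<And>g A. g \<in> carrier G \<Longrightarrow> A \<in> V \<Longrightarrow> conj_act R g A \<in> V"
    using V by (auto simp: irreducible_rep_def subrep_def)
  note lin = op_linearD[OF T(1)]
  have "linear T"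
    by (rule linearI) (simp_all add: lin flip: of_real_op_scale)
  moreover have "subspace V"
    using sV(1) by (simp add: subspace_def cop.subspace_def flip: of_real_op_scale)
  moreover have "T A \<bullet> B = A \<bullet> T B" for A B
    by (simp add: T(3) flip: Re_hs_inner)
  ultimately obtain c A where A: "A \<in> V" "A \<noteq> 0" "T A = c *\<^sub>R A"
    using symmetric_eigenvector[of T V] sV(2) inv by blast
  let ?E = "{A \<in> V. T A = of_real c *\<^sub>o A}"
  have "subrep G R ?E"
    unfolding subrep_def
  proof
    show "cop.subspace ?E"
      using sV(1) by (simp add: cop.subspace_def lin cop.scale_right_distrib mult.commute)
    show "\<forall>g\<in>carrier G. \<forall>A\<in>?E. conj_act R g A \<in> ?E"
      using sV(3) T(2) by (simp add: equivariant_def op_linearD[OF op_linear_conj_act])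
  qed
  moreover have "?E \<noteq> {0}"
    using A by (auto simp: of_real_op_scale)
  ultimately have "?E = V"
    using V unfolding irreducible_rep_def by blast
  then show ?thesis
    by (auto simp: of_real_op_scale)
qed

section \<open>The coefficients \<open>W\<^sub>t(j)\<close>\<close>

lemma conj_act_subrep:
  assumes qms: "quantum_metric_space G \<E> R" and "subrep G R V" and g: "g \<in> carrier G"
  shows "(R g)\<^sup>\<dagger> ** R g = mat 1" and "conj_act R g ` V = V"
proof -
  have G: "group G" and R: "R \<in> hom G (isom_group \<E>)"
    using qms by (auto simp: quantum_metric_space_def)
  have uni: "(R h)\<^sup>\<dagger> ** R h = mat 1" if "h \<in> carrier G" for h
    using hom_in_carrier[OF R that] by (simp add: isom_group_def unitary_def)
  have mult: "R (x \<otimes>\<^bsub>G\<^esub> y) = R x ** R y" if "x \<in> carrier G" "y \<in> carrier G" for x y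
    using hom_mult[OF R that] by (simp add: isom_group_def)
  show "(R g)\<^sup>\<dagger> ** R g = mat 1"
    using uni g by blast
  have one: "\<one>\<^bsub>G\<^esub> \<in> carrier G" and inv: "inv\<^bsub>G\<^esub> g \<in> carrier G"
    using G g by (simp_all add: group.is_monoid monoid.one_closed)
  \<comment> \<open>The image of the neutral element is idempotent and unitary, so cancelling one
    factor shows that it is the identity.\<close>
  have "(R \<one>\<^bsub>G\<^esub>)\<^sup>\<dagger> ** (R \<one>\<^bsub>G\<^esub> ** R \<one>\<^bsub>G\<^esub>) = (R \<one>\<^bsub>G\<^esub>)\<^sup>\<dagger> ** R \<one>\<^bsub>G\<^esub>"
    using mult[OF one one] one G by (simp add: group.is_monoid monoid.l_one)
  then have "R \<one>\<^bsub>G\<^esub> = mat 1"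
    using uni[OF one] by (simp add: matrix_mul_assoc)
  then have RR: "R g ** R (inv\<^bsub>G\<^esub> g) = mat 1"
    using mult[OF g inv] G g by (simp add: group.r_inv)
  have "conj_act R g (conj_act R (inv\<^bsub>G\<^esub> g) A) = A" for A
  proof -
    have "conj_act R g (conj_act R (inv\<^bsub>G\<^esub> g) A)
        = (R g ** R (inv\<^bsub>G\<^esub> g)) ** A ** (R g ** R (inv\<^bsub>G\<^esub> g))\<^sup>\<dagger>"
      by (simp only: conj_act_def adj_mult matrix_mul_assoc)
    then show ?thesis
      by (simp add: RR)
  qed
  moreover have "conj_act R h A \<in> V" if "h \<in> carrier G" "A \<in> V" for h A
    using assms(2) that by (simp add: subrep_def)
  ultimately show "conj_act R g ` V = V"
    using g inv by (metis image_subset_iff imageI subsetI subset_antisym)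
qed

lemma Phi_equivariant:
  assumes "quantum_metric_space G \<E> R" "subrep G R (sphere_space \<E> t)"
  shows "equivariant G R (Phi \<E> t)"
  unfolding equivariant_def
proof (intro ballI allI)
  fix g A assume "g \<in> carrier G"
  from conj_act_subrep[OF assms this] show "Phi \<E> t (conj_act R g A) = conj_act R g (Phi \<E> t A)"
    unfolding conj_act_def by (rule Phi_conj_unitary)
qed

text \<open>\<open>Phi\<close> preserves each sphere space and acts there as a real scalar; applying
  it to the resolution of \<open>X\<close> into its projections yields the formula, for arbitrary
  \<open>X\<close>.\<close>

lemma Phi_decomposition:
  assumes qms: "quantum_metric_space G \<E> R" and mf: "multiplicity_free G R"
    and hom: "two_homogeneous G \<E> R" and t: "t \<le> metric_diameter \<E>"
  shows "\<exists>w. \<forall>X. Phi \<E> t X = (\<Sum>j\<le>metric_diameter \<E>. w j *\<^sub>R Proj \<E> j X)"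
proof -
  have qg: "quantum_graph \<E>" and con: "metric_connected \<E>"
    using qms by (auto simp: quantum_metric_space_def)
  have irr: "irreducible_rep G R (sphere_space \<E> j)" if "j \<le> metric_diameter \<E>" for j
    using hom that by (simp add: two_homogeneous_def)
  have eqv: "equivariant G R (Phi \<E> t)"
    using irr[OF t] by (intro Phi_equivariant qms) (simp add: irreducible_rep_def)
  have "\<exists>c. \<forall>A\<in>sphere_space \<E> j. Phi \<E> t A = c *\<^sub>R A" if "j \<le> metric_diameter \<E>" for j
    using irr[OF that] multiplicity_free_invariant[OF mf irr[OF that] Phi_linear eqv]
    by (intro Schur_scalar[OF _ Phi_linear eqv] Phi_symmetric qg)
  then obtain w where w: "\<And>j A. j \<le> metric_diameter \<E> \<Longrightarrow> A \<in> sphere_space \<E> j \<Longrightarrow> Phi \<E> t A = w j *\<^sub>R A"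
    by metis
  have "Phi \<E> t X = (\<Sum>j\<le>metric_diameter \<E>. w j *\<^sub>R Proj \<E> j X)" for X
  proof -
    have "Phi \<E> t X = Phi \<E> t (\<Sum>j\<le>metric_diameter \<E>. Proj \<E> j X)"
      by (simp add: sum_Proj[OF qg con])
    also have "\<dots> = (\<Sum>j\<le>metric_diameter \<E>. w j *\<^sub>R Proj \<E> j X)"
      unfolding op_linear_sum[OF Phi_linear] by (intro sum.cong refl w Proj_in) simp
    finally show ?thesis .
  qed
  then show ?thesis
    by blast
qed

section \<open>Existence and uniqueness of the coefficients\<close>

text \<open>Supplies test operators: the coefficients are characterized on self-adjoint operators
  only. If \<open>A + A\<^sup>\<dagger>\<close> vanishes, then \<open>A\<close> is anti-self-adjoint
  and its multiple by the imaginary unit serves.\<close>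

lemma adj_closed_self_adjoint_nonzero:
  assumes V: "cop.subspace V" "V \<noteq> {0}" and adj: "\<And>A. A \<in> V \<Longrightarrow> A\<^sup>\<dagger> \<in> V"
  obtains X where "X \<in> V" "X \<noteq> 0" "self_adjoint X"
proof -
  obtain A where A: "A \<in> V" "A \<noteq> 0"
    using V cop.subspace_0 by blast
  show thesis
  proof (cases "A + A\<^sup>\<dagger> = 0")
    case True
    then have "A\<^sup>\<dagger> = - A"
      by (simp add: add_eq_0_iff)
    then have "self_adjoint (\<i> *\<^sub>o A)"
      by (simp add: self_adjoint_def adj_scale)
    then show thesis
      using A V(1) by (intro that[of "\<i> *\<^sub>o A"]) (auto simp: cop.subspace_scale)
  next
    case False
    then show thesis
      using A V(1) adj
      by (intro that[of "A + A\<^sup>\<dagger>"]) (auto simp: cop.subspace_add self_adjoint_def adj_add add.commute)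
  qed
qed

lemma Phi_eq_sum_W_coeff:
  assumes qms: "quantum_metric_space G \<E> R" and mf: "multiplicity_free G R"
    and hom: "two_homogeneous G \<E> R" and t: "t \<le> metric_diameter \<E>" and X: "self_adjoint X"
  shows "Phi \<E> t X = (\<Sum>j\<le>metric_diameter \<E>. W_coeff \<E> t j *\<^sub>R Proj \<E> j X)"
proof -
  define r where "r = metric_diameter \<E>"
  define Q where "Q w \<longleftrightarrow> (\<forall>j>r. w j = 0) \<and>
    (\<forall>X. self_adjoint X \<longrightarrow> Phi \<E> t X = (\<Sum>j\<le>r. w j *\<^sub>R Proj \<E> j X))" for w :: "nat \<Rightarrow> real"
  have qg: "quantum_graph \<E>"
    using qms by (simp add: quantum_metric_space_def)
  obtain w where w: "\<And>X. Phi \<E> t X = (\<Sum>j\<le>r. w j *\<^sub>R Proj \<E> j X)"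
    using Phi_decomposition[OF qms mf hom t] by (auto simp: r_def)
  \<comment> \<open>The coefficients are cut off beyond the diameter to meet the normalization in
    \<open>W_coeff\<close>.\<close>
  have "Q (\<lambda>j. if j \<le> r then w j else 0)"
    by (auto simp: Q_def w intro: sum.cong)
  moreover have "v = v'" if "Q v" "Q v'" for v v'
  proof
    fix j
    show "v j = v' j"
    proof (cases "j \<le> r")
      case True
      then have "sphere_space \<E> j \<noteq> {0}"
        using hom by (simp add: two_homogeneous_def irreducible_rep_def r_def)
      then obtain X where X: "X \<in> sphere_space \<E> j" "X \<noteq> 0" "self_adjoint X"
        using adj_closed_self_adjoint_nonzero[OF sphere_space_subspace] sphere_space_adj[OF qg]
        by metis
      \<comment> \<open>On a self-adjoint \<open>X\<close> in the sphere space of index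
        \<open>j\<close>, all other projections vanish, so \<open>Phi\<close> reads off the
        coefficient at \<open>j\<close>.\<close>
      have "Phi \<E> t X = u j *\<^sub>R X" if "Q u" for u
      proof -
        have "Phi \<E> t X = (\<Sum>i\<le>r. u i *\<^sub>R Proj \<E> i X)"
          using that X(3) by (simp add: Q_def)
        also have "\<dots> = (\<Sum>i\<le>r. if i = j then u j *\<^sub>R X else 0)"
          using Proj_fixes[OF X(1)] Proj_other[OF qg X(1)] by (intro sum.cong) auto
        finally show ?thesis
          using True by simp
      qed
      then show ?thesis
        using that X(2) by (metis scaleR_cancel_right)
    next
      case False
      then show ?thesis
        using that by (simp add: Q_def)
    qed
  qed
  ultimately have "Q (THE w. Q w)"
    by (metis theI)
  moreover have "(THE w. Q w) = W_coeff \<E> t"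
    by (simp add: W_coeff_def Q_def r_def)
  ultimately show ?thesis
    using X by (simp add: Q_def r_def)
qed


section \<open>The linear system for a code\<close>

lemma trace_Proj:
  assumes "P\<^sup>\<dagger> = P"
  shows "trace (P ** Proj \<E> t P) = of_real (\<Sum>A\<in>sphere_basis \<E> t. (cmod (trace (P ** A)))\<^sup>2)"
proof -
  have "trace (P ** Proj \<E> t P) = (\<Sum>A\<in>sphere_basis \<E> t. trace (A\<^sup>\<dagger> ** P) * trace (P ** A))"
    by (simp add: Proj_def matrix_mult_sum trace_sum op_scale_mult_right trace_scale)
  also have "\<dots> = (\<Sum>A\<in>sphere_basis \<E> t. of_real ((cmod (trace (P ** A)))\<^sup>2))"
  proof (intro sum.cong refl)
    fix A
    have "trace (A\<^sup>\<dagger> ** P) = cnj (trace (P ** A))"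
      using assms trace_adj[of "P ** A"] by (simp add: adj_mult)
    then show "trace (A\<^sup>\<dagger> ** P) * trace (P ** A) = of_real ((cmod (trace (P ** A)))\<^sup>2)"
      by (simp only: complex_norm_square mult.commute)
  qed
  finally show ?thesis
    by simp
qed

text \<open>Cyclicity of the trace and \<open>P = P ** P\<close> turn the trace of
  \<open>P ** A ** P ** A\<^sup>\<dagger>\<close> into the squared Hilbert-Schmidt norm of the
  compression \<open>P ** A ** P\<close>.\<close>

lemma trace_Phi:
  assumes "P\<^sup>\<dagger> = P" "P ** P = P"
  shows "trace (P ** Phi \<E> t P)
    = of_real (\<Sum>A\<in>sphere_basis \<E> t. Re (hs_inner (P ** A ** P) (P ** A ** P)))"
proof -
  have "trace (P ** (A ** P ** A\<^sup>\<dagger>)) = hs_inner (P ** A ** P) (P ** A ** P)" for A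
  proof -
    have PP: "X ** P ** P = X ** P" for X
      by (metis assms(2) matrix_mul_assoc)
    have "hs_inner (P ** A ** P) (P ** A ** P) = trace ((P ** A\<^sup>\<dagger>) ** (P ** A ** P))"
      by (simp add: hs_inner_def adj_mult assms(1) matrix_mul_assoc PP)
    also have "\<dots> = trace ((P ** A ** P) ** (P ** A\<^sup>\<dagger>))"
      by (rule trace_mul_sym)
    finally show ?thesis
      by (simp add: matrix_mul_assoc PP)
  qed
  then show ?thesis
    by (simp add: Phi_def matrix_mult_sum trace_sum flip: hs.ip_self_real)
qed

lemma lp_solution_distance_distribution:
  fixes \<E> :: "'n::finite cop set"
  assumes qms: "quantum_metric_space G \<E> R" and mf: "multiplicity_free G R"
    and hom: "two_homogeneous G \<E> R" and "d \<le> metric_diameter \<E>"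
    and code: "quantum_code \<E> C K d"
  shows "lp_solution (W_coeff \<E>) (metric_diameter \<E>) K d (distance_distribution \<E> C)"
proof -
  define P where "P = code_proj C"
  define n where "n = real CARD('n)"
  define k where "k = real K"
  define r where "r = metric_diameter \<E>"
  define A where "A = distance_distribution \<E> C"
  define M where "M E = P ** E ** P" for E
  have qg: "quantum_graph \<E>"
    using qms by (simp add: quantum_metric_space_def)
  have C: "vec.subspace C" "vec.dim C = K"
    using code by (auto simp: quantum_code_def)
  have P: "P ** P = P" "P\<^sup>\<dagger> = P" "trace P = of_real k"
    using code_proj_props[OF C(1)] by (simp_all add: P_def C(2) k_def)
  have pos: "k > 0" "n > 0"
    using quantum_code_dim_pos[OF code] by (simp_all add: k_def n_def)
  have PP: "hs_inner P P = of_real k"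
    by (simp add: hs_inner_def P)
  \<comment> \<open>Idempotence and cyclicity let \<open>E\<close> be replaced by its compression,
    so that both trace formulas involve the same operator \<open>M E\<close>.\<close>
  have PM: "trace (P ** E) = hs_inner P (M E)" for E
    using trace_mul_sym[of P "E ** P"] trace_mul_sym[of E P]
    by (simp add: hs_inner_def M_def P matrix_mul_assoc)
      (metis P(1) matrix_mul_assoc trace_mul_sym)
  have A_eq: "A t = n / k * (\<Sum>E\<in>sphere_basis \<E> t. (cmod (hs_inner P (M E)))\<^sup>2)" for t
    unfolding A_def distance_distribution_def P_def[symmetric] trace_Proj[OF P(2)]
    unfolding PM by (simp add: C(2) flip: n_def k_def)
  have W_eq: "k * (\<Sum>j\<le>r. W_coeff \<E> t j * A j)
      = n * (\<Sum>E\<in>sphere_basis \<E> t. Re (hs_inner (M E) (M E)))" if "t \<le> r" for t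
  proof -
    have "(\<Sum>E\<in>sphere_basis \<E> t. Re (hs_inner (M E) (M E))) = Re (trace (P ** Phi \<E> t P))"
      by (simp add: trace_Phi[OF P(2,1)] M_def)
    also have "Phi \<E> t P = (\<Sum>j\<le>r. W_coeff \<E> t j *\<^sub>R Proj \<E> j P)"
      using Phi_eq_sum_W_coeff[OF qms mf hom, of t P] that P(2) by (simp add: self_adjoint_def r_def)
    also have "Re (trace (P ** \<dots>)) = (\<Sum>j\<le>r. W_coeff \<E> t j * Re (trace (P ** Proj \<E> j P)))"
      by (simp add: matrix_mult_sum trace_sum op_scale_mult_right trace_scale flip: of_real_op_scale)
    finally show ?thesis
      using pos
      by (simp add: A_def distance_distribution_def C(2) sum_distrib_left mult_ac flip: P_def n_def k_def)
  qed
  have le: "A t \<le> k * (\<Sum>j\<le>r. W_coeff \<E> t j * A j)" if "t \<le> r" for t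
  proof -
    have "(\<Sum>E\<in>sphere_basis \<E> t. (cmod (hs_inner P (M E)))\<^sup>2)
        \<le> k * (\<Sum>E\<in>sphere_basis \<E> t. Re (hs_inner (M E) (M E)))"
      using hs.Cauchy_Schwarz_ip[of P] by (simp add: sum_distrib_left sum_mono PP)
    then show ?thesis
      unfolding W_eq[OF that] A_eq[of t] using pos by (simp add: field_simps)
  qed
  have eq: "k * (\<Sum>j\<le>r. W_coeff \<E> t j * A j) = A t" if "t < d" for t
  proof -
    have "(cmod (hs_inner P (M E)))\<^sup>2 = k * Re (hs_inner (M E) (M E))"
      if "E \<in> sphere_basis \<E> t" for E
    proof -
      have "E \<in> op_power \<E> (d - 1)"
        using sphere_basis_subset[OF that] sphere_space_subset[of \<E> t]
          op_power_mono[OF qg, of t "d - 1"] \<open>t < d\<close> by force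
      \<comment> \<open>Here \<open>t < d\<close> forces \<open>1 \<le> d\<close>, so the real
        difference \<open>real d - 1\<close> matches the natural number
        \<open>d - 1\<close>.\<close>
      moreover have "graph_metric \<E> (real d - 1) = op_power \<E> (d - 1)"
        using graph_metric_of_nat[of \<E> "d - 1"] \<open>t < d\<close> by (simp add: of_nat_diff)
      ultimately have "detects C E"
        using code unfolding quantum_code_def has_distance_def detects_below_def by blast
      \<comment> \<open>Detection makes \<open>M E\<close> proportional to \<open>P\<close>, and
        both sides of the Cauchy-Schwarz inequality become the squared modulus of \<open>e\<close>
        times \<open>k\<^sup>2\<close>.\<close>
      then obtain e where "M E = e *\<^sub>o P"
        by (auto simp: detects_def M_def P_def)
      moreover have re: "Re (e * (cnj e * of_real k)) = k * (cmod e)\<^sup>2"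
        unfolding cmod_power2 by (simp add: power2_eq_square algebra_simps)
      ultimately show ?thesis
        using pos
        by (simp only: hs.ip_scale_left hs.ip_scale_right PP norm_mult norm_of_real re)
          (simp add: power_mult_distrib power2_eq_square)
    qed
    then have "(\<Sum>E\<in>sphere_basis \<E> t. (cmod (hs_inner P (M E)))\<^sup>2)
        = k * (\<Sum>E\<in>sphere_basis \<E> t. Re (hs_inner (M E) (M E)))"
      by (simp add: sum_distrib_left)
    moreover have "t \<le> r"
      using that assms(4) by (simp add: r_def)
    ultimately show ?thesis
      using pos by (simp add: W_eq A_eq[of t])
  qed
  have "A 0 = k"
  proof -
    have nI: "hs_inner (mat 1 :: 'n cop) (mat 1) = of_real n"
      by (simp add: hs_inner_def trace_I n_def)
    \<comment> \<open>The sphere space of index 0 is spanned by the identity, of squared norm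
      \<open>n\<close>, and \<open>P\<close> has trace \<open>k\<close>. Hence the trace of
      \<open>P ** Proj \<E> 0 P\<close> is \<open>k\<^sup>2 / n\<close>, and the prefactor
      \<open>n / k\<close> leaves \<open>k\<close>.\<close>
    have "Proj \<E> 0 P = (of_real (k / n)) *\<^sub>o mat 1"
      unfolding Proj_eq_expansion
    proof (rule hs.expansion_unique[OF sphere_basis_props(1,2)])
      have sp: "cop.span (sphere_basis \<E> 0) = cop.span {mat 1}"
        using sphere_basis_props(3)[of \<E> 0] by (simp add: sphere_space_def)
      show "of_real (k / n) *\<^sub>o mat 1 \<in> cop.span (sphere_basis \<E> 0)"
        unfolding sp by (intro cop.span_scale cop.span_base) simp
      have perp: "hs_inner (mat 1) (P - of_real (k / n) *\<^sub>o mat 1) = 0"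
        using pos nI by (simp add: hs.ip_diff_right hs.ip_scale_right) (simp add: hs_inner_def P)
      show "hs_inner Y (P - of_real (k / n) *\<^sub>o mat 1) = 0"
        if "Y \<in> cop.span (sphere_basis \<E> 0)" for Y
        using hs.orthogonal_span[OF _ that[unfolded sp]] perp by blast
    qed
    then have "trace (P ** Proj \<E> 0 P) = of_real (k / n) * of_real k"
      by (simp add: op_scale_mult_right trace_scale P)
    then show ?thesis
      using pos by (simp add: A_def distance_distribution_def C(2) flip: P_def n_def k_def)
  qed
  moreover have "0 \<le> A t" for t
    using pos by (simp add: A_eq sum_nonneg)
  ultimately show ?thesis
    using le eq by (simp add: lp_solution_def A_def r_def k_def)
qed

theorem theorem3p2p1:
  fixes G :: "('g, 'm) monoid_scheme"
    and \<E> :: "(complex ^ 'n ^ 'n) set"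
    and R :: "'g \<Rightarrow> complex ^ 'n ^ 'n"
    and r K d :: nat
  assumes "quantum_metric_space G \<E> R"
    and "multiplicity_free G R"
    and "two_homogeneous G \<E> R"
    and "r = metric_diameter \<E>"
    and "1 \<le> d" and "d \<le> r"
  shows "(\<forall>C. quantum_code \<E> C K d \<longrightarrow>
            lp_solution (W_coeff \<E>) r K d (distance_distribution \<E> C)) \<and>
         ((\<nexists>A. lp_solution (W_coeff \<E>) r K d A) \<longrightarrow> (\<nexists>C. quantum_code \<E> C K d))"
  using lp_solution_distance_distribution[OF assms(1-3)] assms(4,6) by blast

end
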